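(* Define $\varphi_2$ on complex polynomials as follows: $\varphi_2(c)=0$ for every constant polynomial $c$; for a nonconstant prime polynomial $P$, $$\varphi_2(P)=\begin{cases} 4 & \text{if } \deg P=4 \text{ and } P\notin H(z^4),\\ 1 & \text{otherwise;}\end{cases}$$ and for a nonconstant polynomial $P$ with prime decomposition $P=P_1\circ\cdots\circ P_n$, $\varphi_2(P)=\varphi_2(P_1)\cdots\varphi_2(P_n)$. Then $\varphi_2$ is well defined (independent of the chosen prime decomposition) and is a multiplicative character on $\mathcal{P}ol(\mathbb{C})$; it is not elementary; and it cannot be extended to rational functions, i.e. there is no multiplicative character $\Phi:\mathcal{R}at(\mathbb{C})\to\mathbb{C}$ with $\Phi|_{\mathcal{P}ol(\mathbb{C})}=\varphi_2$.
   Context: $\mathcal{P}ol(\mathbb{C})$ is the semigroup (under composition) of all complex polynomials, constants included. $\mathcal{R}at(\mathbb{C})$ is the semigroup (under composition) of all rational functions $\widehat{\mathbb{C}}\to\widehat{\mathbb{C}}$ of the Riemann sphere, constants included; $\mathcal{P}ol(\mathbb{C})$ is a subsemigroup of it. A multiplicative character on a semigroup $S$ is a map $\varphi:S\to\mathbb{C}$ with $\varphi(st)=\varphi(s)\varphi(t)$ for all $s,t\in S$. A multiplicative character $\varphi$ on $\mathcal{P}ol(\mathbb{C})$ is elementary if $\varphi(P)=f(\deg P)$ for all $P$, for some function $f$ with $f(nm)=f(n)f(m)$. A nonconstant polynomial $P$ is prime if whenever $P=Q\circ R$ with $Q,R$ polynomials, $\deg Q=1$ or $\deg R=1$ (so degree-one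 polynomials are prime). A prime decomposition of $P$ is an expression $P=P_1\circ\cdots\circ P_n$ with every $P_i$ prime. For a rational map $R$, its Hurwitz class is $H(R)=\{Q\in\mathcal{R}at(\mathbb{C}) : \exists\,\phi,\psi \text{ homeomorphisms of } \widehat{\mathbb{C}} \text{ with } Q\circ\phi=\psi\circ R\}$. *)

theory Defs
  imports "HOL-Analysis.Analysis" "HOL-Computational_Algebra.Polynomial"
begin

text \<open>The Riemann sphere is the type \<^typ>\<open>complex option\<close>, with \<^term>\<open>None\<close> as the
  point at infinity, carrying the topology of the one-point compactification.\<close>

type_synonym sphere = "complex option"

definition sphere_topology :: "sphere topology" where
  "sphere_topology = Alexandroff_compactification euclidean"

lemma topspace_sphere_topology [simp]: "topspace sphere_topology = UNIV"
  by (auto simp: sphere_topology_def UNIV_option_conv)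

text \<open>The point with homogeneous coordinates \<open>[a : b]\<close>; only used with \<open>(a, b) \<noteq> (0, 0)\<close>.\<close>

definition sphere_point :: "complex \<Rightarrow> complex \<Rightarrow> sphere" where
  "sphere_point a b = (if b = 0 then None else Some (a / b))"

text \<open>The self-map of the sphere given by a fraction \<open>p / q\<close> in lowest terms. The value at
  infinity is read off from the coefficients at the common degree of the homogenisations.
  The case \<open>q = 0\<close> is the constant map with value infinity.\<close>

definition rational_map :: "complex poly \<Rightarrow> complex poly \<Rightarrow> sphere \<Rightarrow> sphere" where
  "rational_map p q z = (case z of
      Some w \<Rightarrow> sphere_point (poly p w) (poly q w)
    | None \<Rightarrow> (let n = max (degree p) (degree q) in sphere_point (coeff p n) (coeff q n)))"

definition Rat :: "(sphere \<Rightarrow> sphere) set" where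
  "Rat = {rational_map p q | p q. coprime p q}"

text \<open>Polynomials form a semigroup under \<^const>\<open>pcompose\<close>; the following map embeds it
  into \<^term>\<open>Rat\<close> under composition of maps.\<close>

definition poly_map :: "complex poly \<Rightarrow> sphere \<Rightarrow> sphere" where
  "poly_map P = rational_map P 1"

lemma poly_map_Some [simp]: "poly_map P (Some w) = Some (poly P w)"
  by (simp add: poly_map_def rational_map_def sphere_point_def)

lemma poly_map_None:
  "poly_map P None = (if degree P = 0 then Some (coeff P 0) else None)"
  by (simp add: poly_map_def rational_map_def sphere_point_def)

lemma poly_map_in_Rat: "poly_map P \<in> Rat"
  unfolding Rat_def poly_map_def mem_Collect_eq
  by (intro exI[of _ P] exI[of _ 1]) simp

lemma inj_poly_map: "inj poly_map"
proof (rule injI)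
  fix P Q assume "poly_map P = poly_map Q"
  then have "poly P w = poly Q w" for w
    using poly_map_Some[of P w] poly_map_Some[of Q w] by simp
  then show "P = Q"
    by (simp add: poly_eq_poly_eq_iff [symmetric] fun_eq_iff)
qed

lemma poly_map_pcompose: "poly_map (pcompose P Q) = poly_map P \<circ> poly_map Q"
proof
  fix z
  show "poly_map (pcompose P Q) z = (poly_map P \<circ> poly_map Q) z"
  proof (cases z)
    case None
    have "coeff (pcompose P Q) 0 = poly P (coeff Q 0)"
      by (simp add: poly_0_coeff_0 [symmetric] poly_pcompose)
    moreover have "coeff P 0 = poly P x" if "degree P = 0" for x
      using that by (auto elim: degree_eq_zeroE)
    ultimately show ?thesis
      using None by (auto simp: poly_map_None degree_pcompose)
  qed (simp add: poly_pcompose)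
qed

definition Hurwitz_class :: "(sphere \<Rightarrow> sphere) \<Rightarrow> (sphere \<Rightarrow> sphere) set" where
  "Hurwitz_class R = {Q \<in> Rat. \<exists>\<phi> \<psi>.
      homeomorphic_map sphere_topology sphere_topology \<phi> \<and>
      homeomorphic_map sphere_topology sphere_topology \<psi> \<and>
      Q \<circ> \<phi> = \<psi> \<circ> R}"

definition mult_character :: "'a set \<Rightarrow> ('a \<Rightarrow> 'a \<Rightarrow> 'a) \<Rightarrow> ('a \<Rightarrow> complex) \<Rightarrow> bool" where
  "mult_character S mul \<phi> \<longleftrightarrow> (\<forall>s\<in>S. \<forall>t\<in>S. \<phi> (mul s t) = \<phi> s * \<phi> t)"

text \<open>Constants, including the zero polynomial, have degree \<open>0\<close>.\<close>

definition elementary :: "(complex poly \<Rightarrow> complex) \<Rightarrow> bool" where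
  "elementary \<phi> \<longleftrightarrow>
    (\<exists>f :: nat \<Rightarrow> complex. (\<forall>n m. f (n * m) = f n * f m) \<and> (\<forall>P. \<phi> P = f (degree P)))"

text \<open>Primality with respect to composition, not to multiplication.\<close>

definition comp_prime :: "complex poly \<Rightarrow> bool" where
  "comp_prime P \<longleftrightarrow> degree P > 0 \<and>
    (\<forall>Q R. P = pcompose Q R \<longrightarrow> degree Q = 1 \<or> degree R = 1)"

definition comp_list :: "complex poly list \<Rightarrow> complex poly" where
  "comp_list Ps = foldr pcompose Ps [:0, 1:]"

definition prime_decomposition :: "complex poly \<Rightarrow> complex poly list \<Rightarrow> bool" where
  "prime_decomposition P Ps \<longleftrightarrow>
    Ps \<noteq> [] \<and> (\<forall>Q\<in>set Ps. comp_prime Q) \<and> P = comp_list Ps"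

definition phi2_prime :: "complex poly \<Rightarrow> complex" where
  "phi2_prime P =
    (if degree P = 4 \<and> poly_map P \<notin> Hurwitz_class (poly_map (monom 1 4)) then 4 else 1)"

text \<open>The description is proper exactly when the product does not depend on the chosen
  prime decomposition.\<close>

definition phi2 :: "complex poly \<Rightarrow> complex" where
  "phi2 P = (if degree P = 0 then 0
     else (THE v. \<exists>Ps. prime_decomposition P Ps \<and> v = prod_list (map phi2_prime Ps)))"

end

theory Submission
  imports
    Defs
    "HOL-Computational_Algebra.Computational_Algebra"
    "HOL-Computational_Algebra.Field_as_Ring"
begin

text \<open>A quartic in the Hurwitz class of \<open>z\<^sup>4\<close> is \<open>c (z - a)\<^sup>4 + w\<close>, which is not prime. So
  \<open>\<phi>\<^sub>2(P)\<close> counts the prime factors of degree \<open>4\<close>, and well-definedness is the part of Ritt's first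
  theorem on the degrees of prime factors.

  Given \<open>f\<close> of degree \<open>n\<close>, let \<open>X\<close> be a Laurent series in \<open>u\<close> with \<open>f(X) = c u\<^sup>-\<^sup>n\<close>. The
  substitutions \<open>u \<mapsto> \<zeta> u\<close> with \<open>\<zeta>\<^sup>n = 1\<close> permute the roots \<open>X(\<zeta> u)\<close> of \<open>f(Y) = f(X)\<close>, and if \<open>b\<close> is a
  right factor of \<open>f\<close> of degree \<open>m\<close>, the polynomials in \<open>b\<close> are those \<open>p\<close> for which \<open>p(X)\<close> is a
  series in \<open>u\<^sup>m\<close>. Hence two right factors \<open>b\<close>, \<open>d\<close> are polynomials in a common \<open>e\<close> of degree
  \<open>gcd (deg b) (deg d)\<close>, and for coprime degrees \<open>f\<close> is a polynomial in a common left multiple of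
  degree \<open>deg b \<cdot> deg d\<close>. Comparing the last factors of two prime decompositions, induction on
  the degree finishes.

  On rational maps an extension would have to respect an identity coming from the quotient of the
  sphere by \<open>S\<^sub>4\<close>: a prime quartic composed with a cubic equals, up to Moebius maps, a cubic composed
  with two quadratic maps. The two sides have values \<open>4\<close> and \<open>1\<close>.\<close>

subsection \<open>Ring homomorphisms and polynomials\<close>

text \<open>The instances are the embedding of constants, the substitution \<open>u -> z u\<close>,
  evaluation at a series, and the coefficientwise extension of these to polynomials.\<close>

definition is_ring_hom :: "('a::comm_ring_1 \<Rightarrow> 'b::comm_ring_1) \<Rightarrow> bool" where
  "is_ring_hom h \<longleftrightarrow> h 0 = 0 \<and> h 1 = 1 \<and> (\<forall>x y. h (x + y) = h x + h y) \<and> (\<forall>x y. h (x * y) = h x * h y)"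

lemma is_ring_homD:
  assumes "is_ring_hom h"
  shows "h 0 = 0" "h 1 = 1" "h (x + y) = h x + h y" "h (x * y) = h x * h y"
    "h (- x) = - h x" "h (x - y) = h x - h y"
proof -
  show 1: "h 0 = 0" "h 1 = 1" "h (x + y) = h x + h y" "h (x * y) = h x * h y" for x y
    using assms by (auto simp: is_ring_hom_def)
  show 2: "h (- x) = - h x" for x
    using 1(3)[of x "- x"] 1(1) by (simp add: eq_neg_iff_add_eq_0 add.commute)
  show "h (x - y) = h x - h y"
    using 1(3)[of x "- y"] 2[of y] by simp
qed

lemma is_ring_hom_sum: "is_ring_hom h \<Longrightarrow> h (sum g S) = (\<Sum>i\<in>S. h (g i))"
  by (induction S rule: infinite_finite_induct) (simp_all add: is_ring_homD)

lemma is_ring_hom_prod: "is_ring_hom h \<Longrightarrow> h (prod g S) = (\<Prod>i\<in>S. h (g i))"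
  by (induction S rule: infinite_finite_induct) (simp_all add: is_ring_homD)

lemma is_ring_hom_map_poly:
  assumes "is_ring_hom h"
  shows "is_ring_hom (map_poly h)"
  unfolding is_ring_hom_def
proof (intro conjI allI)
  show "map_poly h (p + q) = map_poly h p + map_poly h q" for p q
    by (intro poly_eqI) (simp add: coeff_map_poly is_ring_homD[OF assms])
  show "map_poly h (p * q) = map_poly h p * map_poly h q" for p q
    by (intro poly_eqI) (simp add: coeff_map_poly coeff_mult is_ring_homD[OF assms] is_ring_hom_sum[OF assms])
qed (simp_all add: is_ring_homD[OF assms])

lemma is_ring_hom_poly:
  assumes "is_ring_hom h"
  shows "h (poly p x) = poly (map_poly h p) (h x)"
  by (induction p) (simp_all add: is_ring_homD[OF assms] map_poly_pCons)

lemma is_ring_hom_fls_const: "is_ring_hom (fls_const :: 'a::comm_ring_1 \<Rightarrow> _)"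
  by (simp add: is_ring_hom_def fls_plus_const)

subsection \<open>Laurent series\<close>

unbundle fps_syntax
unbundle no vec_syntax

definition scale_fls :: "'a::field \<Rightarrow> 'a fls \<Rightarrow> 'a fls" where
  "scale_fls z F = fls_compose_fps F (fps_const z * fps_X)"

lemma scale_fls_nth:
  \<comment> \<open>The hypothesis makes \<open>z powi k\<close> meaningful for negative
    \<open>k\<close>.\<close>
  assumes "z \<noteq> 0"
  shows "scale_fls z F $$ k = z powi k * F $$ k"
proof -
  \<comment> \<open>\<open>fls_compose_fps\<close> substitutes separately into \<open>u^d\<close>
    and into the remaining power series; the contributions \<open>z^d\<close> and
    \<open>z^(k - d)\<close> are recombined at the end.\<close>
  define d where "d = fls_subdegree F"
  have "fps_to_fls (fps_const z * fps_X) powi d = fls_const (z powi d) * fls_X_intpow d"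
    by (simp add: fls_times_fps_to_fls power_int_mult_distrib flip: fls_const_power_int)
  then have "scale_fls z F = fps_to_fls (fls_base_factor_to_fps F oo (fps_const z * fps_X)) *
      (fls_const (z powi d) * fls_X_intpow d)"
    by (simp only: scale_fls_def fls_compose_fps_def d_def)
  also have "\<dots> = fls_const (z powi d) * (fls_X_intpow d *
      fps_to_fls (fls_base_factor_to_fps F oo (fps_const z * fps_X)))"
    by (simp only: mult_ac)
  also have "\<dots> = fls_const (z powi d) *
      fls_shift (- d) (fps_to_fls (fls_base_factor_to_fps F oo (fps_const z * fps_X)))"
    by (simp only: fls_X_intpow_times_conv_shift)
  finally have "scale_fls z F $$ k = (if k < d then 0 else z powi d * (z ^ nat (k - d) * F $$ k))"
    by (simp add: fls_base_factor_to_fps_nth d_def)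
  also have "\<dots> = z powi k * F $$ k"
  proof (cases "k < d")
    case False
    then have "z powi d * z ^ nat (k - d) = z powi k"
      using assms by (simp flip: power_int_of_nat power_int_add)
    then show ?thesis using False by (simp flip: mult.assoc)
  qed (simp add: d_def)
  finally show ?thesis .
qed

lemma is_ring_hom_scale_fls: "z \<noteq> 0 \<Longrightarrow> is_ring_hom (scale_fls z)"
  by (simp add: is_ring_hom_def scale_fls_def fls_compose_fps_mult fls_compose_fps_add)

lemma scale_fls_const [simp]: "scale_fls z (fls_const c) = fls_const c"
  by (simp add: scale_fls_def)

lemma map_poly_scale_const: "map_poly (scale_fls z) (map_poly fls_const p) = map_poly fls_const p"
  by (simp add: map_poly_map_poly scale_fls_def o_def)

text \<open>\<open>c\<close> may be \<open>0\<close>, so the condition only bounds the order below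
  by \<open>d\<close> and records the coefficient there. Sums and products then need no case
  distinction on cancellation.\<close>

definition fls_lead :: "'a::zero fls \<Rightarrow> int \<Rightarrow> 'a \<Rightarrow> bool" where
  "fls_lead F d c \<longleftrightarrow> (\<forall>i<d. F $$ i = 0) \<and> F $$ d = c"

lemma fls_lead_add: "fls_lead F d c \<Longrightarrow> fls_lead G d c' \<Longrightarrow> fls_lead (F + G) d (c + c')"
  by (auto simp: fls_lead_def)

lemma fls_lead_const: "fls_lead (fls_const c) 0 c"
  by (auto simp: fls_lead_def)

lemma fls_lead_less: "fls_lead F d c \<Longrightarrow> e < d \<Longrightarrow> fls_lead F e 0"
  by (auto simp: fls_lead_def)

lemma fls_lead_mult:
  fixes F G :: "'a::idom fls"
  assumes "fls_lead F d c" "fls_lead G e c'"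
  shows "fls_lead (F * G) (d + e) (c * c')"
proof (cases "F = 0 \<or> G = 0")
  case True
  then show ?thesis using assms by (auto simp: fls_lead_def)
next
  case False
  then have "d \<le> fls_subdegree F" "e \<le> fls_subdegree G"
    using assms by (auto simp: fls_lead_def intro!: fls_subdegree_geI)
  then consider "d = fls_subdegree F" "e = fls_subdegree G" | "d + e < fls_subdegree F + fls_subdegree G"
    by linarith
  then show ?thesis
  proof cases
    case 1
    then show ?thesis
      using assms fls_times_base[of F G] by (auto simp: fls_lead_def fls_times_nth_eq0)
  next
    case 2
    have "c * c' = 0"
    proof (cases "d < fls_subdegree F")
      case False
      then have "e < fls_subdegree G" using 2 by linarith
      then show ?thesis using assms by (auto simp: fls_lead_def)
    qed (use assms in \<open>auto simp: fls_lead_def\<close>)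
    then show ?thesis using 2
      by (auto simp: fls_lead_def fls_times_nth_eq0)
  qed
qed

lemma fls_lead_prod:
  fixes F :: "'b \<Rightarrow> 'a::idom fls"
  assumes "\<And>i. i \<in> S \<Longrightarrow> fls_lead (F i) d (c i)"
  shows "fls_lead (prod F S) (int (card S) * d) (prod c S)"
  using assms
proof (induction S rule: infinite_finite_induct)
  case (insert x S)
  have "fls_lead (F x * prod F S) (d + int (card S) * d) (c x * prod c S)"
    by (intro fls_lead_mult insert) (use insert in auto)
  then show ?case using insert by (simp add: algebra_simps)
qed (use fls_lead_const[of 1] in simp_all)

text \<open>As \<open>d\<close> is negative, the highest power of \<open>F\<close> reaches furthest
  down. A bound \<open>k\<close> instead of the exact degree lets the induction pass through
  vanishing top coefficients.\<close>

lemma fls_lead_poly: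
  fixes F :: "'a::idom fls"
  assumes "fls_lead F d c" "d < 0" "degree p \<le> k"
  shows "fls_lead (poly (map_poly fls_const p) F) (int k * d) (coeff p k * c ^ k)"
  using assms(3)
proof (induction p arbitrary: k)
  case 0
  then show ?case by (simp add: fls_lead_def)
next
  case (pCons a p)
  show ?case
  proof (cases k)
    case 0
    then have "p = 0" using pCons.prems by (auto split: if_splits)
    with 0 show ?thesis by (simp add: map_poly_pCons fls_lead_const)
  next
    case (Suc j)
    have "fls_lead (poly (map_poly fls_const p) F) (int j * d) (coeff p j * c ^ j)"
      using pCons Suc by (auto split: if_splits)
    from fls_lead_mult[OF assms(1) this]
    have "fls_lead (F * poly (map_poly fls_const p) F) (int k * d) (coeff (pCons a p) k * c ^ k)"
      by (simp add: Suc algebra_simps)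
    moreover have "fls_lead (fls_const a) (int k * d) 0"
      using assms(2) Suc by (intro fls_lead_less[OF fls_lead_const]) (simp add: mult_less_0_iff)
    ultimately show ?thesis
      using fls_lead_add by (fastforce simp: map_poly_pCons)
  qed
qed

text \<open>\<open>H\<close> is the divided difference of \<open>p\<close>; since \<open>F\<close>
  and \<open>G\<close> share their leading term, that of \<open>H\<close> is the one of the
  derivative \<open>p'\<close> at \<open>F\<close>.\<close>

lemma poly_fls_diff_factor:
  fixes F G :: "'a::idom fls"
  assumes F: "fls_lead F d c" and G: "fls_lead G d c" and "d < 0" "degree p \<le> Suc k"
  shows "\<exists>H. poly (map_poly fls_const p) F - poly (map_poly fls_const p) G = (F - G) * H \<and>
     fls_lead H (int k * d) (of_nat (Suc k) * coeff p (Suc k) * c ^ k)"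
  using assms(4)
proof (induction p arbitrary: k)
  case 0
  show ?case by (intro exI[of _ 0]) (simp add: fls_lead_def)
next
  case (pCons a p)
  let ?e = "\<lambda>H. poly (map_poly fls_const p) H"
  have dp: "degree p \<le> k" using pCons.prems by (auto split: if_splits)
  have 1: "fls_lead (?e F) (int k * d) (coeff p k * c ^ k)"
    by (rule fls_lead_poly[OF F \<open>d < 0\<close> dp])
  show ?case
  proof (cases k)
    case 0
    then obtain b where "p = [:b:]" using dp by (auto elim: degree_eq_zeroE)
    then show ?thesis using 1 0
      by (intro exI[of _ "?e F"]) (simp add: map_poly_pCons algebra_simps)
  next
    case (Suc j)
    obtain H where H: "?e F - ?e G = (F - G) * H"
      "fls_lead H (int j * d) (of_nat (Suc j) * coeff p (Suc j) * c ^ j)"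
      using pCons.IH[of j] dp Suc by auto
    have "F * ?e F - G * ?e G = (F - G) * ?e F + G * (?e F - ?e G)"
      by (simp add: algebra_simps)
    then have "poly (map_poly fls_const (pCons a p)) F - poly (map_poly fls_const (pCons a p)) G
        = (F - G) * (?e F + G * H)"
      by (simp add: map_poly_pCons H(1) algebra_simps)
    moreover have "fls_lead (?e F + G * H) (int k * d)
        (coeff p k * c ^ k + c * (of_nat (Suc j) * coeff p (Suc j) * c ^ j))"
    proof (rule fls_lead_add[OF 1])
      show "fls_lead (G * H) (int k * d) (c * (of_nat (Suc j) * coeff p (Suc j) * c ^ j))"
        using fls_lead_mult[OF G H(2)] by (simp add: Suc algebra_simps)
    qed
    moreover have "coeff p k * c ^ k + c * (of_nat (Suc j) * coeff p (Suc j) * c ^ j) =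
        of_nat (Suc k) * coeff (pCons a p) (Suc k) * c ^ k"
      by (simp add: Suc algebra_simps)
    ultimately show ?thesis
      by (intro exI[of _ "?e F + G * H"]) simp
  qed
qed

text \<open>In characteristic zero the divided difference is non-zero and can be cancelled, so a
  solution of \<open>p(Y) = s\<close> is determined by its leading term.\<close>

lemma poly_fls_inj:
  fixes F G :: "'a::{idom,ring_char_0} fls"
  assumes "fls_lead F d c" "fls_lead G d c" "d < 0" "c \<noteq> 0" "degree p > 0"
    and eq: "poly (map_poly fls_const p) F = poly (map_poly fls_const p) G"
  shows "F = G"
proof -
  obtain k where k: "degree p = Suc k" using assms(5) by (cases "degree p") auto
  obtain H where H: "(F - G) * H = 0"
    "fls_lead H (int k * d) (of_nat (Suc k) * coeff p (Suc k) * c ^ k)"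
    using poly_fls_diff_factor[OF assms(1-3), of p k] k eq by auto
  have "coeff p (Suc k) \<noteq> 0" using k by (metis degree_0 nat.distinct(1) leading_coeff_0_iff)
  then have "H \<noteq> 0" using H(2) assms(4) by (auto simp: fls_lead_def simp del: of_nat_Suc)
  then show ?thesis using H(1) by simp
qed

section \<open>Series in \<open>u^m\<close> as invariants of the \<open>m\<close>-th roots of
  unity\<close>

definition fls_supported :: "nat \<Rightarrow> 'a::zero fls \<Rightarrow> bool" where
  "fls_supported m F \<longleftrightarrow> (\<forall>k. F $$ k \<noteq> 0 \<longrightarrow> int m dvd k)"

lemma fls_supportedI_scale:
  fixes F :: "complex fls"
  assumes "m > 0" and inv: "\<And>z. z ^ m = 1 \<Longrightarrow> scale_fls z F = F"
  shows "fls_supported m F"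
  unfolding fls_supported_def
proof safe
  fix k assume k: "F $$ k \<noteq> 0"
  let ?r = "\<lambda>k::nat. cis (2 * pi * real k / real m)"
  \<comment> \<open>A primitive \<open>m\<close>-th root of unity: invariance forces
    \<open>?z powi k = 1\<close>, and \<open>k\<close> is then replaced by its residue
    \<open>j\<close>.\<close>
  let ?z = "?r 1"
  have bij: "bij_betw ?r {..<m} {z. z ^ m = 1}"
    by (rule Complex.bij_betw_roots_unity[OF \<open>m > 0\<close>])
  have pw: "?z ^ j = ?r j" for j
    by (simp add: Complex.DeMoivre mult_ac)
  have zm: "?z ^ m = 1" using pw[of m] \<open>m > 0\<close> by simp
  have z0: "?z \<noteq> 0" by simp
  define j where "j = nat (k mod int m)"
  have j: "j < m" "int j = k mod int m" using \<open>m > 0\<close> by (auto simp: j_def nat_less_iff)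
  have "?z powi k * F $$ k = F $$ k"
    using inv[OF zm] scale_fls_nth[OF z0, of F k] by simp
  then have "1 = ?z powi k" using k by simp
  also have "k = int m * (k div int m) + int j" using j by simp
  also have "?z powi \<dots> = (?z ^ m) powi (k div int m) * ?z ^ j"
    using z0 by (simp add: power_int_add power_int_mult)
  also have "\<dots> = ?r j" unfolding zm pw by simp
  finally have "?r j = ?r 0" by simp
  then have "j = 0" using bij j(1) \<open>m > 0\<close> by (meson bij_betw_imp_inj_on inj_onD lessThan_iff)
  then show "int m dvd k" using j(2) by auto
qed

lemma scale_fls_supported:
  assumes "fls_supported m F" "z ^ m = 1" "m > 0"
  shows "scale_fls z F = F"
proof (rule fls_eqI)
  fix k
  have z: "z \<noteq> 0" using assms by (auto simp: power_0_left)
  show "scale_fls z F $$ k = F $$ k"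
  proof (cases "F $$ k = 0")
    case False
    then obtain l where "k = int m * l" using assms(1) by (auto simp: fls_supported_def)
    then have "z powi k = 1" using assms(2) by (simp add: power_int_mult)
    then show ?thesis by (simp add: scale_fls_nth z)
  qed (simp add: scale_fls_nth z)
qed

abbreviation poly_fls :: "'a::comm_ring_1 poly \<Rightarrow> 'a fls \<Rightarrow> 'a fls" where
  "poly_fls p F \<equiv> poly (map_poly fls_const p) F"

lemma is_ring_hom_poly_fls: "is_ring_hom (\<lambda>p. poly_fls p F)"
proof -
  note h = is_ring_homD[OF is_ring_hom_map_poly[OF is_ring_hom_fls_const]]
  show ?thesis by (simp add: is_ring_hom_def h)
qed

lemmas poly_fls_hom = is_ring_homD[OF is_ring_hom_poly_fls]

lemma poly_fls_pcompose: "poly_fls (pcompose p q) F = poly_fls p (poly_fls q F)"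
proof (induction p)
  case (pCons a p)
  have "poly_fls (pcompose (pCons a p) q) F = poly_fls [:a:] F + poly_fls q F * poly_fls (pcompose p q) F"
    by (simp only: pcompose_pCons poly_fls_hom)
  then show ?case using pCons by (simp add: map_poly_pCons)
qed simp

lemma scale_fls_poly: "z \<noteq> 0 \<Longrightarrow> scale_fls z (poly_fls p F) = poly_fls p (scale_fls z F)"
  using is_ring_hom_poly[OF is_ring_hom_scale_fls] map_poly_scale_const by metis

lemma poly_fls_fps_of_poly:
  assumes "V $ 0 = 0"
  shows "fps_to_fls (fps_of_poly q oo V) = poly_fls q (fps_to_fls (V :: 'a::field fps))"
proof (induction q)
  case (pCons a q)
  have "fps_of_poly (pCons a q) oo V = fps_const a + V * (fps_of_poly q oo V)"
    using assms by (simp add: fps_of_poly_pCons fps_compose_add_distrib fps_compose_mult_distrib mult.commute)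
  then show ?case using pCons by (simp add: map_poly_pCons fls_times_fps_to_fls)
qed simp

subsection \<open>Right factors of a polynomial and its expansion at infinity\<close>

text \<open>With \<open>V\<close> the compositional inverse of \<open>(f(1/w)/c)\<^sup>-\<^sup>1\<^sup>/\<^sup>n\<close>, the root is \<open>X = 1/V\<close>.\<close>

lemma exists_root_at_infinity:
  fixes f :: "complex poly"
  assumes "degree f = n" "n > 0"
  shows "\<exists>X. fls_lead X (- 1) 1 \<and> poly_fls f X = fls_const (lead_coeff f) * fls_X_intpow (- int n)"
proof -
  define c where "c = lead_coeff f"
  have c: "c \<noteq> 0" using assms by (auto simp: c_def)
  \<comment> \<open>\<open>R\<close> is \<open>w^n f(1/w)\<close>; division by \<open>c\<close>
    makes the constant term 1, so that an \<open>n\<close>-th root exists.\<close>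
  define R where "R = fps_of_poly (reflect_poly f)"
  define W where "W = fps_const (1 / c) * R"
  have W0: "W $ 0 = 1" using c by (simp add: W_def R_def c_def)
  define rad where "rad = fps_radical (\<lambda>_ _. 1) n W"
  have rad_n: "rad ^ n = W"
    using power_radical[of W "\<lambda>_ _. 1" "n - 1"] W0 assms(2) by (simp add: rad_def)
  have rad0: "rad $ 0 = 1" using assms(2) by (cases n) (simp_all add: rad_def)
  \<comment> \<open>\<open>U^n\<close> is \<open>c / f(1/w)\<close>, and \<open>U = w + ...\<close>
    has a compositional inverse \<open>V\<close>. Putting \<open>w = V(u)\<close> gives
    \<open>c / f(1/V) = u^n\<close>.\<close>
  define U where "U = fps_X * inverse rad"
  have U0: "U $ 0 = 0" by (simp add: U_def)
  have U1: "U $ 1 = 1" using rad0 by (simp add: U_def)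
  define V where "V = fps_inv U"
  have V0: "V $ 0 = 0" by (simp add: V_def fps_inv_def)
  have UV: "U oo V = fps_X" unfolding V_def by (rule fps_inv_right) (use U0 U1 in simp_all)
  have V1: "V $ 1 = 1"
  proof -
    have "(U oo V) $ 1 = U $ 1 * V $ 1" by (simp add: fps_compose_nth V0 U0)
    then show ?thesis unfolding UV U1 by simp
  qed
  have "U * rad = fps_X" using rad0 by (simp add: U_def mult.assoc inverse_mult_eq_1)
  then have "U ^ n * W = fps_X ^ n" by (metis power_mult_distrib rad_n)
  then have "(U ^ n * W) oo V = fps_X ^ n oo V" by simp
  then have 1: "fps_X ^ n * (fps_const (1 / c) * (R oo V)) = V ^ n"
    using V0 by (simp add: W_def fps_compose_mult_distrib UV flip: fps_compose_power)
  define v where "v = fps_to_fls V"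
  have v0: "v \<noteq> 0" using V1 by (auto simp: v_def)
  have vsub: "fls_subdegree v = 1" using V0 V1
    by (intro fls_subdegree_eqI) (auto simp: v_def)
  define X where "X = inverse v"
  have "v ^ n * poly_fls f X = poly_fls (reflect_poly f) v"
  proof -
    have "map_poly fls_const (reflect_poly f) = reflect_poly (map_poly fls_const f)"
      by (intro poly_eqI) (simp add: coeff_map_poly coeff_reflect_poly degree_map_poly)
    then show ?thesis
      using poly_reflect_poly_nz[OF v0, of "map_poly fls_const f"] assms(1)
      by (simp add: X_def degree_map_poly)
  qed
  also have "\<dots> = fps_to_fls (R oo V)"
    using poly_fls_fps_of_poly[OF V0] by (simp add: R_def v_def)
  finally have 2: "v ^ n * poly_fls f X = fps_to_fls (R oo V)" .
  have "v ^ n = fls_X ^ n * (fls_const (1 / c) * fps_to_fls (R oo V))"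
    using arg_cong[OF 1, of fps_to_fls]
    by (simp add: fls_times_fps_to_fls fps_to_fls_power v_def)
  also have "\<dots> = v ^ n * (fls_X ^ n * fls_const (1 / c) * poly_fls f X)"
    unfolding 2[symmetric] by (simp only: mult_ac)
  finally have 5: "v ^ n = v ^ n * (fls_X ^ n * fls_const (1 / c) * poly_fls f X)" .
  have "v ^ n * (fls_X ^ n * fls_const (1 / c) * poly_fls f X) = v ^ n * 1"
    unfolding mult_1_right by (rule 5[symmetric])
  then have 3: "fls_X ^ n * fls_const (1 / c) * poly_fls f X = 1"
    by (rule mult_left_cancel[THEN iffD1, rotated]) (use v0 in simp)
  have "poly_fls f X = (fls_const c * fls_const (1 / c)) * (fls_X_intpow (- int n) * fls_X ^ n) * poly_fls f X"
  proof -
    have "fls_const c * fls_const (1 / c) = 1" using c by simp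
    moreover have "fls_X_intpow (- int n) * fls_X ^ n = (1 :: complex fls)"
      unfolding fls_X_power_conv_shift_1 by (subst fls_X_intpow_times_fls_X_intpow) simp
    ultimately show ?thesis by (simp only: mult_1_left)
  qed
  also have "\<dots> = fls_const c * fls_X_intpow (- int n) * (fls_X ^ n * fls_const (1 / c) * poly_fls f X)"
    by (simp only: mult_ac)
  finally have 4: "poly_fls f X = fls_const c * fls_X_intpow (- int n)" unfolding 3 by (simp only: mult_1_right)
  have "X * v = 1" using v0 by (simp add: X_def)
  moreover have X0: "X \<noteq> 0" using v0 by (simp add: X_def)
  ultimately have "fls_subdegree X + fls_subdegree v = 0"
    using v0 fls_subdegree_mult[of X v] by simp
  then have sX: "fls_subdegree X = -1" using vsub by simp
  have "X $$ (-1) * v $$ 1 = 1"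
    using fls_times_base[of X v] \<open>X * v = 1\<close> vsub sX by simp
  then have "fls_lead X (-1) 1" using V1 sX by (auto simp: fls_lead_def v_def)
  then show ?thesis using 4 c_def by auto
qed

text \<open>The leading term \<open>1/u\<close> of \<open>X\<close> lets degrees be read off as pole
  orders, and gives \<open>X(z u)\<close> the leading coefficient \<open>1/z\<close>, which tells
  the conjugates apart.\<close>

locale root_at_infinity =
  fixes f :: "complex poly" and X :: "complex fls"
  assumes deg_pos: "degree f > 0"
    and lead_X: "fls_lead X (- 1) 1"
    and f_X: "poly_fls f X = fls_const (lead_coeff f) * fls_X_intpow (- int (degree f))"
begin

lemma lead_poly_fls: "degree p \<le> k \<Longrightarrow> fls_lead (poly_fls p X) (- int k) (coeff p k)"
  using fls_lead_poly[OF lead_X, of p k] by simp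

text \<open>\<open>X\<close> is transcendental over the constants: for non-zero \<open>p\<close> the
  series \<open>p(X)\<close> has order exactly \<open>- degree p\<close>.\<close>

lemma poly_fls_eq_iff [simp]: "poly_fls p X = poly_fls q X \<longleftrightarrow> p = q"
proof
  assume "poly_fls p X = poly_fls q X"
  then have "poly_fls (p - q) X = 0" by (simp add: poly_fls_hom)
  then have "lead_coeff (p - q) = 0"
    using lead_poly_fls[of "p - q" "degree (p - q)"] by (auto simp: fls_lead_def)
  then show "p = q" by (metis leading_coeff_0_iff right_minus_eq)
qed simp

lemma fls_supported_f:
  assumes "m dvd degree f"
  shows "fls_supported m (poly_fls f X)"
  using assms by (auto simp: fls_supported_def f_X fls_X_intpow_times_conv_shift eq_neg_iff_add_eq_0[symmetric])

text \<open>For \<open>z ^ degree b = 1\<close> the scaled series of \<open>b(X)\<close> is again a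
  root of \<open>a(Y) = f(X)\<close>, because \<open>f(X)\<close> is a monomial with exponent
  divisible by \<open>degree b\<close>. It has the same leading term as \<open>b(X)\<close>, hence
  equals it.\<close>

lemma fls_supported_right_factor:
  assumes "f = pcompose a b"
  shows "fls_supported (degree b) (poly_fls b X)"
proof (rule fls_supportedI_scale)
  have deg: "degree f = degree a * degree b" by (simp add: assms degree_pcompose)
  then show pos: "degree b > 0" using deg_pos by simp
  fix z :: complex assume z: "z ^ degree b = 1"
  then have z0: "z \<noteq> 0" using pos by (auto simp: power_0_left)
  have lead: "fls_lead (poly_fls b X) (- int (degree b)) (lead_coeff b)"
    by (rule lead_poly_fls) simp
  show "scale_fls z (poly_fls b X) = poly_fls b X"
  proof (rule poly_fls_inj[of _ "- int (degree b)" "lead_coeff b" _ a])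
    show "fls_lead (scale_fls z (poly_fls b X)) (- int (degree b)) (lead_coeff b)"
      using lead z by (auto simp: fls_lead_def scale_fls_nth[OF z0] power_int_minus)
    have "z ^ degree f = 1" using z by (simp add: deg mult.commute[of "degree a"] power_mult)
    then have "scale_fls z (poly_fls f X) = poly_fls f X"
      by (intro scale_fls_supported[OF fls_supported_f]) (use deg_pos in auto)
    then show "poly_fls a (scale_fls z (poly_fls b X)) = poly_fls a (poly_fls b X)"
      by (simp add: scale_fls_poly[OF z0, symmetric] poly_fls_pcompose[symmetric] flip: assms)
  qed (use lead pos deg deg_pos in auto)
qed

lemma fls_supported_degree_dvd:
  assumes "fls_supported m (poly_fls p X)"
  shows "m dvd degree p"
proof (cases "p = 0")
  case False
  then have "poly_fls p X $$ (- int (degree p)) \<noteq> 0"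
    using lead_poly_fls[of p "degree p"] by (auto simp: fls_lead_def)
  then show ?thesis using assms by (auto simp: fls_supported_def)
qed simp

end

lemma fls_supported_poly:
  fixes F :: "complex fls"
  assumes "fls_supported m F" "m > 0"
  shows "fls_supported m (poly_fls p F)"
proof (rule fls_supportedI_scale[OF \<open>m > 0\<close>])
  fix z :: complex assume z: "z ^ m = 1"
  then have "z \<noteq> 0" using assms(2) by (auto simp: power_0_left)
  then show "scale_fls z (poly_fls p F) = poly_fls p F"
    by (simp add: scale_fls_poly scale_fls_supported[OF assms(1) z assms(2)])
qed

lemma fls_supported_diff:
  "fls_supported m F \<Longrightarrow> fls_supported m G \<Longrightarrow> fls_supported m (F - G)"
  unfolding fls_supported_def by (metis diff_zero diff_self fls_minus_nth)

context root_at_infinity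
begin

text \<open>Every degree in the algebra of all \<open>p\<close> with \<open>p(X)\<close> supported on multiples of \<open>m\<close> is a
  multiple of \<open>m\<close>, so an element of degree \<open>m\<close> generates it.\<close>

lemma fls_supported_imp_pcompose:
  assumes e: "fls_supported m (poly_fls e X)" "degree e = m" "m > 0"
    and "fls_supported m (poly_fls p X)"
  shows "\<exists>q. p = pcompose q e"
  using assms(4)
proof (induction "degree p" arbitrary: p rule: less_induct)
  case less
  show ?case
  proof (cases "degree p = 0")
    case True
    then obtain a where "p = [:a:]" by (auto elim: degree_eq_zeroE)
    then show ?thesis by (intro exI[of _ "[:a:]"]) simp
  next
    case False
    obtain k where k: "degree p = m * k"
      using fls_supported_degree_dvd[OF less.prems] by blast
    \<comment> \<open>Subtracting \<open>a e^k\<close> cancels the leading term of \<open>p\<close>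
      and stays inside the algebra.\<close>
    define a where "a = lead_coeff p / lead_coeff e ^ k"
    define q where "q = pcompose (monom a k) e"
    have e0: "lead_coeff e \<noteq> 0" using e by auto
    have "a \<noteq> 0" using False e0 by (auto simp: a_def)
    then have degq: "degree q = degree p"
      by (simp add: q_def degree_pcompose degree_monom_eq k e)
    have "lead_coeff q = lead_coeff p"
      using e(2,3) e0 \<open>a \<noteq> 0\<close> by (simp add: q_def lead_coeff_comp lead_coeff_monom degree_monom_eq a_def)
    then have "coeff (p - q) (degree p) = 0" using degq by simp
    then have "degree (p - q) < degree p"
      using degree_diff_le[of p "degree p" q] degq False
      by (metis le_neq_implies_less le_refl degree_0 leading_coeff_0_iff neq0_conv)
    moreover have "fls_supported m (poly_fls (p - q) X)"
      using fls_supported_diff[OF less.prems] fls_supported_poly[OF e(1) e(3), of "monom a k"]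
      by (simp add: poly_fls_hom poly_fls_pcompose q_def)
    ultimately obtain r where "p - q = pcompose r e" using less.hyps by blast
    then have "p = pcompose (r + monom a k) e"
      by (simp add: pcompose_add q_def algebra_simps)
    then show ?thesis by blast
  qed
qed

end

section \<open>Conjugates of the root and the common right factor\<close>

lemma poly_eq_prod_roots:
  fixes p :: "'a::idom poly"
  assumes "finite S" "card S = degree p" "\<And>x. x \<in> S \<Longrightarrow> poly p x = 0"
  shows "p = smult (lead_coeff p) (\<Prod>x\<in>S. [:- x, 1:])"
proof (rule ccontr)
  let ?P = "\<Prod>x\<in>S. [:- x, 1:]"
  define q where "q = p - smult (lead_coeff p) ?P"
  assume "p \<noteq> smult (lead_coeff p) ?P"
  then have q0: "q \<noteq> 0" by (simp add: q_def)
  then have p0: "p \<noteq> 0" by (auto simp: q_def)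
  have monic: "lead_coeff ?P = 1" by (simp add: lead_coeff_prod)
  have deg: "degree ?P = degree p"
    using assms(2) by (subst degree_prod_eq_sum_degree) auto
  then have "coeff q (degree p) = 0" using monic by (simp add: q_def)
  moreover have "degree q \<le> degree p" using deg by (simp add: q_def degree_diff_le)
  ultimately have less: "degree q < degree p"
    using q0 by (metis le_neq_implies_less leading_coeff_0_iff)
  \<comment> \<open>\<open>q\<close> vanishes on all of \<open>S\<close> although its degree is
    below \<open>card S\<close>.\<close>
  have "S \<subseteq> {x. poly q x = 0}"
    using assms(1,3) by (auto simp: q_def poly_prod prod_zero_iff)
  then have "card S \<le> degree q"
    using card_poly_roots_bound[OF q0] poly_roots_finite[OF q0] by (meson card_mono order_trans)
  then show False using less assms(2) by simp
qed

lemma fls_lead_unique: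
  "fls_lead F d c \<Longrightarrow> fls_lead F e c' \<Longrightarrow> c \<noteq> 0 \<Longrightarrow> c' \<noteq> 0 \<Longrightarrow> d = e"
  unfolding fls_lead_def by (metis linorder_neqE)

lemma scale_fls_scale_fls:
  "w \<noteq> 0 \<Longrightarrow> z \<noteq> 0 \<Longrightarrow> scale_fls w (scale_fls z F) = scale_fls (w * z) F"
  by (intro fls_eqI) (simp add: scale_fls_nth power_int_mult_distrib)

abbreviation unity_roots :: "nat \<Rightarrow> complex set" where
  "unity_roots m \<equiv> {z. z ^ m = 1}"

lemma unity_roots_nonzero: "m > 0 \<Longrightarrow> z \<in> unity_roots m \<Longrightarrow> z \<noteq> 0"
  by (auto simp: power_0_left)

lemma unity_roots_Int_gcd:
  assumes "z ^ m = 1" "z ^ l = (1::complex)" "m > 0"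
  shows "z ^ gcd m l = 1"
proof -
  obtain x y where "m * x = l * y + gcd m l" using bezout_nat[of m l] assms(3) by auto
  then have "z ^ (m * x) = z ^ (l * y) * z ^ gcd m l" by (simp flip: power_add)
  then show ?thesis using assms by (simp add: power_mult)
qed

lemma prod_unity_roots_mult:
  fixes h :: "complex \<Rightarrow> 'a::comm_monoid_mult"
  assumes "w ^ m = 1" "m > 0"
  shows "(\<Prod>z\<in>unity_roots m. h (w * z)) = (\<Prod>z\<in>unity_roots m. h z)"
proof (rule prod.reindex_bij_betw)
  have w: "w \<noteq> 0" using assms by (auto simp: power_0_left)
  show "bij_betw ((*) w) (unity_roots m) (unity_roots m)"
    using assms w
    by (intro bij_betw_byWitness[of _ "\<lambda>z. z / w"]) (auto simp: power_mult_distrib power_divide)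
qed

context root_at_infinity
begin

lemma lead_scale_X: "z \<noteq> 0 \<Longrightarrow> fls_lead (scale_fls z X) (- 1) (inverse z)"
  using lead_X by (auto simp: fls_lead_def scale_fls_nth power_int_minus)

lemma inj_on_scale_X: "m > 0 \<Longrightarrow> inj_on (\<lambda>z. scale_fls z X) (unity_roots m)"
  by (intro inj_onI) (metis (no_types, lifting) fls_lead_def inverse_inverse_eq lead_scale_X unity_roots_nonzero)

lemma poly_fls_scale_X:
  assumes "fls_supported m (poly_fls b X)" "z \<in> unity_roots m" "m > 0"
  shows "poly_fls b (scale_fls z X) = poly_fls b X"
  using scale_fls_supported[OF assms(1) _ assms(3), of z] assms(2)
    scale_fls_poly[OF unity_roots_nonzero[OF assms(3,2)]] by simp

text \<open>The \<open>m\<close> conjugates \<open>X(z u)\<close> are pairwise distinct zeros of a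
  polynomial of degree \<open>m\<close> in \<open>Y\<close>.\<close>

lemma conjugates_factorization:
  assumes "fls_supported m (poly_fls b X)" "degree b = m" "m > 0"
  shows "map_poly fls_const b - [:poly_fls b X:] =
    smult (fls_const (lead_coeff b)) (\<Prod>z\<in>unity_roots m. [:- scale_fls z X, 1:])"
proof -
  let ?p = "map_poly fls_const b - [:poly_fls b X:]"
  let ?S = "(\<lambda>z. scale_fls z X) ` unity_roots m"
  have deg: "degree ?p = m"
    using assms by (simp add: diff_conv_add_uminus degree_add_eq_left degree_map_poly del: add_uminus_conv_diff)
  have lead: "lead_coeff ?p = fls_const (lead_coeff b)"
    using assms unfolding deg by (cases m) (simp_all add: coeff_map_poly)
  have "?p = smult (lead_coeff ?p) (\<Prod>x\<in>?S. [:- x, 1:])"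
  proof (rule poly_eq_prod_roots)
    show "finite ?S" using assms(3) by (simp add: finite_roots_unity)
    show "card ?S = degree ?p"
      unfolding deg using assms(3) by (simp add: card_image inj_on_scale_X card_roots_unity_eq)
  qed (use assms in \<open>auto simp: poly_fls_scale_X\<close>)
  then show ?thesis
    unfolding lead by (simp add: prod.reindex inj_on_scale_X assms)
qed

text \<open>Take \<open>r \<in> \<complex>[x][Y]\<close> non-zero of least degree in \<open>Y\<close> in the ideal generated by \<open>b(Y) - b(x)\<close> and
  \<open>d(Y) - d(x)\<close>. At \<open>x = X\<close> its roots are the common roots \<open>X(\<zeta> u)\<close>, \<open>\<zeta>\<^sup>g = 1\<close>. By Gauss's lemma the
  primitive part of \<open>r\<close> has constant leading coefficient, so that the product of these roots, which
  has degree \<open>g\<close>, is a polynomial in \<open>X\<close>.\<close>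

lemma exists_gcd_generator:
  assumes b: "fls_supported m (poly_fls b X)" "degree b = m" "m > 0"
    and d: "fls_supported l (poly_fls d X)" "degree d = l" "l > 0"
  shows "\<exists>e. degree e = gcd m l \<and> fls_supported (gcd m l) (poly_fls e X)"
proof -
  define g where "g = gcd m l"
  have g: "g > 0" using b(3) by (simp add: g_def)
  define ev where "ev = (\<lambda>p. poly_fls p X)"
  have ev: "is_ring_hom ev" unfolding ev_def by (rule is_ring_hom_poly_fls)
  have ev_inj: "ev p = 0 \<longleftrightarrow> p = 0" for p
    using poly_fls_eq_iff[of p 0] by (simp add: ev_def)
  note hom = is_ring_homD[OF is_ring_hom_map_poly[OF ev]]
  \<comment> \<open>The outer variable is \<open>Y\<close> and the coefficients are polynomials in
    \<open>x\<close>, so \<open>B b\<close> is \<open>b(Y) - b(x)\<close>; \<open>ev\<close>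
    specialises \<open>x\<close> to \<open>X\<close>.\<close>
  define B where "B = (\<lambda>b :: complex poly. map_poly (\<lambda>c. [:c:]) b - [:b:])"
  have ev_B: "map_poly ev (B b) = map_poly fls_const b - [:poly_fls b X:]" for b
    by (simp add: B_def hom map_poly_map_poly is_ring_homD[OF ev] o_def map_poly_pCons)
       (simp add: ev_def map_poly_pCons)
  have B_deg: "degree (B p) = degree p" "lead_coeff (B p) = [:lead_coeff p:]" if "degree p > 0" for p
  proof -
    show 1: "degree (B p) = degree p"
      using that by (simp add: B_def diff_conv_add_uminus degree_add_eq_left degree_map_poly del: add_uminus_conv_diff)
    show "lead_coeff (B p) = [:lead_coeff p:]"
      unfolding 1 using that by (cases "degree p") (simp_all add: B_def coeff_map_poly)
  qed
  define J where "J = (\<lambda>p. \<exists>U V. p = U * B b + V * B d)"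
  have J_b: "J (B b)" unfolding J_def by (intro exI[of _ 1] exI[of _ 0]) simp
  have J_d: "J (B d)" unfolding J_def by (intro exI[of _ 0] exI[of _ 1]) simp
  have J_comb: "J (smult a p - r * q)" if Jp: "J p" and Jr: "J r" for a p r q
  proof -
    obtain U V U' V' where "p = U * B b + V * B d" "r = U' * B b + V' * B d"
      using Jp Jr by (auto simp: J_def)
    then have "smult a p - r * q = (smult a U - U' * q) * B b + (smult a V - V' * q) * B d"
      by (simp add: algebra_simps smult_add_right)
    then show ?thesis unfolding J_def by blast
  qed
  have "B b \<noteq> 0" using B_deg(1)[of b] b by force
  then obtain r where r: "J r" "r \<noteq> 0" and min: "\<And>p. J p \<Longrightarrow> p \<noteq> 0 \<Longrightarrow> degree r \<le> degree p"
    using ex_has_least_nat[of "\<lambda>p. J p \<and> p \<noteq> 0" "B b" degree] J_b by blast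
  define pp where "pp = primitive_part r"
  have r_eq: "r = smult (content r) pp" by (simp add: pp_def)
  have cont_pp: "content pp = 1" using r(2) by (simp add: pp_def)
  have pp0: "pp \<noteq> 0" using r(2) by (simp add: pp_def)
  \<comment> \<open>Pseudo-division of \<open>p\<close> by \<open>r\<close> leaves a remainder in
    \<open>J\<close>, which is \<open>0\<close> by minimality. The factor \<open>c\<close> that it
    introduces can be cancelled because \<open>pp\<close> has content 1.\<close>
  have pp_dvd: "pp dvd p" if "J p" for p
  proof -
    obtain q s where qs: "pseudo_divmod p r = (q, s)" by (cases "pseudo_divmod p r")
    define c where "c = lead_coeff r ^ (Suc (degree p) - degree r)"
    have c0: "c \<noteq> 0" using r(2) by (simp add: c_def)
    have *: "smult c p = r * q + s" "s = 0 \<or> degree s < degree r"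
      using pseudo_divmod[OF r(2) qs] by (simp_all add: c_def)
    have "J s" using J_comb[OF that r(1), of c q] * by simp
    then have "s = 0" using min[of s] *(2) by force
    then have 1: "smult c p = pp * smult (content r) q"
      using *(1) r_eq by (metis add.right_neutral mult_smult_left mult_smult_right)
    have "content (smult c p) = content (smult (content r) q)"
      unfolding 1 by (simp add: content_mult cont_pp)
    then have "c dvd content (smult (content r) q)" by (metis content_smult dvd_mult2 dvd_normalize_iff dvd_refl)
    then have "[:c:] dvd smult (content r) q" by (simp only: const_poly_dvd_iff_dvd_content)
    then obtain t where "smult (content r) q = [:c:] * t" by (elim dvdE)
    then have "smult c p = smult c (pp * t)" using 1 by simp
    then have "smult c (p - pp * t) = 0" by (simp add: smult_diff_right)
    then have "p = pp * t" using c0 by simp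
    then show ?thesis by simp
  qed
  obtain tb where tb: "B b = pp * tb" using pp_dvd[OF J_b] by blast
  obtain td where td: "B d = pp * td" using pp_dvd[OF J_d] by blast
  \<comment> \<open>The leading coefficient of \<open>B b\<close> in \<open>Y\<close> is a non-zero
    constant, so its divisor \<open>lead_coeff pp\<close> is a unit.\<close>
  have "lead_coeff pp dvd [:lead_coeff b:]"
    using B_deg(2)[of b] b(2,3) tb by (metis dvd_triv_left lead_coeff_mult)
  then have "is_unit (lead_coeff pp)"
    using b by (metis dvd_trans is_unit_const_poly_iff dvd_field_iff leading_coeff_0_iff degree_0 neq0_conv)
  then obtain u where "lead_coeff pp = [:u:]" "is_unit u"
    by (auto simp: is_unit_poly_iff)
  then have u: "lead_coeff pp = [:u:]" "u \<noteq> 0" by auto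
  define P where "P = map_poly ev pp"
  have P_deg: "degree P = degree pp" unfolding P_def by (simp add: degree_map_poly ev_inj)
  have P_lead: "lead_coeff P = fls_const u"
    unfolding P_deg by (simp add: P_def coeff_map_poly is_ring_homD[OF ev] u(1)) (simp add: ev_def map_poly_pCons)
  have P0: "P \<noteq> 0" using P_lead u(2) by auto
  let ?y = "\<lambda>z. scale_fls z X"
  have y_root: "poly (map_poly fls_const b - [:poly_fls b X:]) (?y z) = 0" if "z \<in> unity_roots m" for z
    using poly_fls_scale_X[OF b(1) that b(3)] by simp
  have y_root': "poly (map_poly fls_const d - [:poly_fls d X:]) (?y z) = 0" if "z \<in> unity_roots l" for z
    using poly_fls_scale_X[OF d(1) that d(3)] by simp
  have sub: "unity_roots g \<subseteq> unity_roots m" "unity_roots g \<subseteq> unity_roots l"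
    by (auto simp: g_def) (metis gcd_dvd1 gcd_dvd2 dvdE power_mult power_one)+
  \<comment> \<open>At a common conjugate both generators of \<open>J\<close> vanish, hence so does
    \<open>r\<close>. Its content stays non-zero at \<open>X\<close>, so \<open>P\<close>
    vanishes.\<close>
  have root_P: "poly P (?y z) = 0" if "z \<in> unity_roots g" for z
  proof -
    obtain U V where "r = U * B b + V * B d" using r(1) by (auto simp: J_def)
    then have "map_poly ev r = map_poly ev U * map_poly ev (B b) + map_poly ev V * map_poly ev (B d)"
      by (simp add: hom)
    moreover have "z \<in> unity_roots m" "z \<in> unity_roots l" using that sub by blast+
    ultimately have "poly (map_poly ev r) (?y z) = 0"
      by (simp only: ev_B poly_add poly_mult y_root y_root' mult_zero_right add_0_left)
    moreover have "map_poly ev (smult a pp) = smult (ev a) P" for a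
      by (simp add: P_def map_poly_smult is_ring_homD[OF ev])
    then have "map_poly ev r = smult (ev (content r)) P"
      by (rule trans[OF arg_cong[OF r_eq]])
    ultimately show ?thesis using r(2) ev_inj by simp
  qed
  have card_y: "card (?y ` unity_roots k) = k" if "k > 0" for k
    using that by (simp add: card_image inj_on_scale_X card_roots_unity_eq)
  have "?y ` unity_roots g \<subseteq> {x. poly P x = 0}" using root_P by auto
  then have ge: "g \<le> degree P"
    using card_poly_roots_bound[OF P0] poly_roots_finite[OF P0] card_y[OF g]
    by (metis card_mono order_trans)
  \<comment> \<open>Of the \<open>m\<close> conjugates at most \<open>degree S\<close> are roots of
    \<open>S\<close>. Any other one is a root of \<open>P\<close>, so of \<open>d(Y) - d(X)\<close>;
    lying in both families, it comes from a \<open>g\<close>-th root of unity.\<close>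
  have le: "degree P \<le> g"
  proof -
    define S where "S = map_poly ev tb"
    have PS: "map_poly fls_const b - [:poly_fls b X:] = P * S"
      by (simp add: P_def S_def tb hom flip: ev_B)
    have tb0: "tb \<noteq> 0" using \<open>B b \<noteq> 0\<close> tb by auto
    then have S0: "S \<noteq> 0" unfolding S_def using ev_inj by (simp add: map_poly_eq_0_iff is_ring_homD[OF ev])
    have degs: "degree P + degree S = m"
    proof -
      have "degree S = degree tb" unfolding S_def by (simp add: degree_map_poly ev_inj)
      then show ?thesis using B_deg(1)[of b] b degree_mult_eq[OF pp0 tb0] by (simp add: P_deg tb)
    qed
    let ?R = "?y ` unity_roots g"
    have "?y ` unity_roots m \<subseteq> ?R \<union> {x. poly S x = 0}"
    proof
      fix x assume "x \<in> ?y ` unity_roots m"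
      then obtain z where z: "z \<in> unity_roots m" "x = ?y z" by auto
      show "x \<in> ?R \<union> {x. poly S x = 0}"
      proof (cases "poly S x = 0")
        case False
        then have "poly P x = 0" using y_root[OF z(1)] z(2) unfolding PS by simp
        then have "poly (map_poly ev (B d)) x = 0" by (simp add: td hom flip: P_def)
        then have "poly (smult (fls_const (lead_coeff d)) (\<Prod>z\<in>unity_roots l. [:- ?y z, 1:])) x = 0"
          unfolding ev_B conjugates_factorization[OF d] .
        moreover have "lead_coeff d \<noteq> 0" using d by auto
        ultimately obtain w where w: "w \<in> unity_roots l" "x = ?y w"
          using d(3) by (auto simp: poly_prod finite_roots_unity)
        have "inverse z = inverse w"
          using lead_scale_X[of z] lead_scale_X[of w] unity_roots_nonzero z w b(3) d(3)
          by (metis fls_lead_def)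
        then have "z \<in> unity_roots g"
          using z w b(3) by (auto simp: g_def intro: unity_roots_Int_gcd)
        then show ?thesis using z(2) by blast
      qed simp
    qed
    then have "m \<le> card (?R \<union> {x. poly S x = 0})"
      using card_y[OF b(3)] g poly_roots_finite[OF S0]
      by (metis card_mono finite_Un finite_imageI finite_roots_unity One_nat_def Suc_leI)
    also have "\<dots> \<le> card ?R + card {x. poly S x = 0}" by (rule card_Un_le)
    also have "\<dots> \<le> g + degree S" using card_y[OF g] card_poly_roots_bound[OF S0] by simp
    finally show ?thesis using degs by simp
  qed
  have P_eq: "P = smult (fls_const u) (\<Prod>x\<in>?y ` unity_roots g. [:- x, 1:])"
    unfolding P_lead[symmetric]
    using root_P ge le card_y[OF g] g by (intro poly_eq_prod_roots) (auto simp: finite_roots_unity)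
  \<comment> \<open>The constant coefficient of \<open>pp\<close> in \<open>Y\<close> is a
    polynomial in \<open>x\<close>; at \<open>X\<close> it is, up to a constant, the product of the
    roots of \<open>P\<close>.\<close>
  define e where "e = coeff pp 0"
  have "poly_fls e X = coeff P 0" by (simp add: P_def coeff_map_poly is_ring_homD[OF ev] e_def) (simp add: ev_def)
  also have "\<dots> = poly P 0" by (simp add: poly_0_coeff_0)
  also have "\<dots> = fls_const u * (\<Prod>z\<in>unity_roots g. - ?y z)"
    unfolding P_eq using g by (simp add: poly_prod prod.reindex inj_on_scale_X)
  finally have e_eq: "poly_fls e X = fls_const u * (\<Prod>z\<in>unity_roots g. - ?y z)" .
  have "fls_supported g (poly_fls e X)"
  proof (rule fls_supportedI_scale[OF g])
    fix w :: complex assume w: "w ^ g = 1"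
    then have w0: "w \<noteq> 0" using g by (auto simp: power_0_left)
    note sc = is_ring_hom_scale_fls[OF w0]
    have "scale_fls w (poly_fls e X) = fls_const u * (\<Prod>z\<in>unity_roots g. - scale_fls w (?y z))"
      unfolding e_eq by (simp add: is_ring_homD[OF sc] is_ring_hom_prod[OF sc])
    also have "(\<Prod>z\<in>unity_roots g. - scale_fls w (?y z)) = (\<Prod>z\<in>unity_roots g. - ?y (w * z))"
      using unity_roots_nonzero[OF g] w0 by (intro prod.cong) (auto simp: scale_fls_scale_fls)
    also have "\<dots> = (\<Prod>z\<in>unity_roots g. - ?y z)"
      using prod_unity_roots_mult[OF w g, of "\<lambda>z. - ?y z"] .
    finally show "scale_fls w (poly_fls e X) = poly_fls e X" unfolding e_eq .
  qed
  moreover have "degree e = g"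
  proof -
    \<comment> \<open>Each of the \<open>g\<close> factors has a simple pole, so the product has a
      pole of order \<open>g\<close>, which is the degree of \<open>e\<close>.\<close>
    have "fls_lead (- ?y z) (- 1) (- inverse z)" if "z \<in> unity_roots g" for z
      using lead_scale_X[OF unity_roots_nonzero[OF g that]] by (auto simp: fls_lead_def)
    then have "fls_lead (\<Prod>z\<in>unity_roots g. - ?y z) (int (card (unity_roots g)) * - 1)
        (\<Prod>z\<in>unity_roots g. - inverse z)" by (intro fls_lead_prod)
    from fls_lead_mult[OF fls_lead_const this, of u]
    have "fls_lead (poly_fls e X) (- int g) (u * (\<Prod>z\<in>unity_roots g. - inverse z))"
      using g by (simp add: e_eq card_roots_unity_eq)
    moreover have "u * (\<Prod>z\<in>unity_roots g. - inverse z) \<noteq> 0"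
      using u(2) g unity_roots_nonzero[OF g] by (auto simp: finite_roots_unity)
    moreover have "e \<noteq> 0"
      using calculation by (auto simp: fls_lead_def)
    ultimately show ?thesis
      using fls_lead_unique[OF lead_poly_fls[of e "degree e"]] by force
  qed
  ultimately show ?thesis unfolding g_def by blast
qed

text \<open>The norm of \<open>b\<close> from \<open>\<complex>(x)\<close> to \<open>\<complex>(d)\<close> as a polynomial in \<open>d\<close>.\<close>

lemma exists_norm:
  assumes d: "fls_supported l (poly_fls d X)" "degree d = l" "l > 0" and "b \<noteq> 0"
  shows "\<exists>v k. v \<noteq> 0 \<and> degree v = degree b \<and>
    poly_fls v (poly_fls d X) = fls_const k * (\<Prod>z\<in>unity_roots l. poly_fls b (scale_fls z X))"
  using \<open>b \<noteq> 0\<close>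
proof (induction "degree b" arbitrary: b)
  case 0
  then obtain a where a: "b = [:a:]" "a \<noteq> 0" by (auto elim: degree_eq_zeroE)
  have "(\<Prod>z\<in>unity_roots l. poly_fls b (scale_fls z X)) = fls_const (a ^ l)"
    using d(3) by (simp add: a map_poly_pCons card_roots_unity_eq fls_const_power)
  then have "poly_fls 1 (poly_fls d X) =
      fls_const (inverse (a ^ l)) * (\<Prod>z\<in>unity_roots l. poly_fls b (scale_fls z X))"
    using a(2) by simp
  then show ?case
    using a(1) by (intro exI[of _ 1] exI[of _ "inverse (a ^ l)"]) simp
next
  case (Suc n)
  \<comment> \<open>The norm is multiplicative, so a linear factor is split off; the norm of
    \<open>[:- x, 1:]\<close> is \<open>d(X) - d(x)\<close> up to a constant.\<close>
  then obtain x where "poly b x = 0"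
    using fundamental_theorem_of_algebra[of b] by (auto simp: constant_degree)
  then obtain b' where b': "b = [:- x, 1:] * b'" by (auto simp: poly_eq_0_iff_dvd)
  have "b' \<noteq> 0" using Suc b' by auto
  then have deg: "degree b = Suc (degree b')" by (simp add: b' degree_mult_eq del: mult_pCons_left)
  then obtain v k where "v \<noteq> 0" and vk: "degree v = degree b'"
    "poly_fls v (poly_fls d X) = fls_const k * (\<Prod>z\<in>unity_roots l. poly_fls b' (scale_fls z X))"
    using Suc.hyps(1)[of b'] Suc.hyps(2) \<open>b' \<noteq> 0\<close> by auto
  let ?v = "[:- poly d x, 1:] * v"
  let ?y = "\<lambda>z. scale_fls z X"
  \<comment> \<open>At \<open>Y = x\<close> the factors of \<open>d(Y) - d(X)\<close> are
    \<open>x - X(z u)\<close>. Reversing all \<open>l\<close> of them gives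
    \<open>(- 1) ^ l\<close>, and reversing \<open>d(x) - d(X)\<close> gives the other sign.\<close>
  define c where "c = - lead_coeff d * (- 1) ^ l"
  have "?v \<noteq> 0" using \<open>v \<noteq> 0\<close> by (simp del: mult_pCons_left)
  moreover have "degree ?v = degree b" using vk(1) deg \<open>v \<noteq> 0\<close> by (simp add: degree_mult_eq del: mult_pCons_left)
  moreover have "poly_fls ?v (poly_fls d X) =
      fls_const (c * k) * (\<Prod>z\<in>unity_roots l. poly_fls b (?y z))"
  proof -
    have "fls_const (poly d x) - poly_fls d X =
        poly (map_poly fls_const d - [:poly_fls d X:]) (fls_const x)"
      by (simp add: is_ring_hom_poly[OF is_ring_hom_fls_const])
    also have "\<dots> = fls_const (lead_coeff d) * (\<Prod>z\<in>unity_roots l. - (?y z - fls_const x))"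
      unfolding conjugates_factorization[OF d] by (simp add: poly_prod)
    also have "\<dots> = fls_const (lead_coeff d) *
        (fls_const ((- 1) ^ l) * (\<Prod>z\<in>unity_roots l. ?y z - fls_const x))"
      unfolding prod_uminus card_roots_unity_eq[OF d(3)] by (simp add: fls_const_power)
    finally have prod: "fls_const (poly d x) - poly_fls d X = fls_const (lead_coeff d) *
        (fls_const ((- 1) ^ l) * (\<Prod>z\<in>unity_roots l. ?y z - fls_const x))" .
    have lin: "poly_fls [:- a, 1:] F = F - fls_const a" for a F
      by (simp add: map_poly_pCons)
    have "poly_fls [:- poly d x, 1:] (poly_fls d X) = - (fls_const (poly d x) - poly_fls d X)"
      unfolding lin by simp
    moreover have "fls_const c = - (fls_const (lead_coeff d) * fls_const ((- 1) ^ l))"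
      by (simp add: c_def)
    ultimately have 1: "poly_fls [:- poly d x, 1:] (poly_fls d X) =
       fls_const c * (\<Prod>z\<in>unity_roots l. poly_fls [:- x, 1:] (?y z))"
      unfolding prod lin by (simp only: mult.assoc mult_minus_left)
    have "fls_const (c * k) = fls_const c * fls_const k" by simp
    then show ?thesis unfolding b' poly_fls_hom(4) 1 vk(2) by (simp only: prod.distrib mult_ac)
  qed
  ultimately show ?case by blast
qed

text \<open>For \<open>v\<close> take the norm of \<open>b\<close>: its factors
  \<open>b(X(z u))\<close> are still series in \<open>u^m\<close>, since scaling \<open>u\<close>
  does not move the support.\<close>

lemma exists_lcm_element:
  assumes b: "fls_supported m (poly_fls b X)" "degree b = m" "m > 0"
    and d: "fls_supported l (poly_fls d X)" "degree d = l" "l > 0"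
  shows "\<exists>v. degree v = m \<and> fls_supported m (poly_fls (pcompose v d) X)"
proof -
  have "b \<noteq> 0" using b by auto
  then obtain v k where v: "degree v = m"
    "poly_fls v (poly_fls d X) = fls_const k * (\<Prod>z\<in>unity_roots l. poly_fls b (scale_fls z X))"
    using exists_norm[OF d] b by blast
  have "fls_supported m (poly_fls (pcompose v d) X)"
  proof (rule fls_supportedI_scale[OF \<open>m > 0\<close>])
    fix w :: complex assume w: "w ^ m = 1"
    then have w0: "w \<noteq> 0" using b(3) by (auto simp: power_0_left)
    note sc = is_ring_hom_scale_fls[OF w0]
    have "scale_fls w (poly_fls b (scale_fls z X)) = poly_fls b (scale_fls z X)"
      if "z \<in> unity_roots l" for z
      using scale_fls_supported[OF b(1) w b(3)] unity_roots_nonzero[OF d(3) that] w0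
      by (simp add: scale_fls_scale_fls mult.commute[of w] flip: scale_fls_poly)
         (simp flip: scale_fls_scale_fls)
    then show "scale_fls w (poly_fls (pcompose v d) X) = poly_fls (pcompose v d) X"
      by (simp add: poly_fls_pcompose v(2) is_ring_homD[OF sc] is_ring_hom_prod[OF sc])
  qed
  then show ?thesis using v by blast
qed

end

section \<open>Common right factors and common left multiples\<close>

lemma pcompose_right_cancel:
  fixes a b c :: "'a::idom poly"
  assumes "degree b > 0" "pcompose a b = pcompose c b"
  shows "a = c"
  using pcompose_eq_0[of "a - c" b] assms by (simp add: pcompose_diff)

lemma root_at_infinityE:
  assumes "degree f > 0"
  obtains X where "root_at_infinity f X"
  using exists_root_at_infinity[OF refl assms] assms by (auto simp: root_at_infinity_def)

text \<open>Series in \<open>u^(degree b)\<close> or \<open>u^(degree d)\<close> are series in the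
  power of \<open>u\<close> with the gcd as exponent, so \<open>b\<close> and \<open>d\<close> lie
  in the algebra generated by one \<open>e\<close> of that degree.\<close>

lemma right_factors_gcd:
  fixes a b c d :: "complex poly"
  assumes "pcompose a b = pcompose c d" "degree (pcompose a b) > 0"
  shows "\<exists>e q r. degree e = gcd (degree b) (degree d) \<and> b = pcompose q e \<and> d = pcompose r e"
proof -
  obtain X where "root_at_infinity (pcompose a b) X" using root_at_infinityE assms(2) by blast
  then interpret root_at_infinity "pcompose a b" X .
  have "degree a * degree b > 0" "degree c * degree d > 0"
    using assms(1,2) by (simp_all flip: degree_pcompose)
  then have pos: "degree b > 0" "degree d > 0" by simp_all
  note b = fls_supported_right_factor[OF refl]
  note d = fls_supported_right_factor[OF assms(1)]
  obtain e where e: "degree e = gcd (degree b) (degree d)"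
    "fls_supported (gcd (degree b) (degree d)) (poly_fls e X)"
    using exists_gcd_generator[OF b refl pos(1) d refl pos(2)] by blast
  have gcd0: "gcd (degree b) (degree d) > 0" using pos by simp
  have sup: "fls_supported (gcd (degree b) (degree d)) F"
    if "fls_supported (degree b) F \<or> fls_supported (degree d) F" for F :: "complex fls"
    using that unfolding fls_supported_def by (meson dvd_trans gcd_dvd1 gcd_dvd2 of_nat_dvd_iff)
  show ?thesis
    using fls_supported_imp_pcompose[OF e(2,1) gcd0] sup b d e(1) by metis
qed

text \<open>By coprimality \<open>v(d(X))\<close> is a series in \<open>u\<close> to the power
  \<open>degree b * degree d\<close>, which is also the degree of \<open>pcompose v d\<close>. So
  this polynomial generates the algebra of that exponent, to which the given composite
  belongs.\<close>

lemma right_factors_coprime: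
  fixes a b c d :: "complex poly"
  assumes eq: "pcompose a b = pcompose c d" and "degree (pcompose a b) > 0"
    and cop: "coprime (degree b) (degree d)"
  shows "\<exists>w u v. pcompose u b = pcompose v d \<and> a = pcompose w u \<and> c = pcompose w v \<and>
    degree u = degree d \<and> degree v = degree b"
proof -
  obtain X where "root_at_infinity (pcompose a b) X" using root_at_infinityE assms(2) by blast
  then interpret root_at_infinity "pcompose a b" X .
  have "degree a * degree b > 0" "degree c * degree d > 0"
    using assms(1,2) by (simp_all flip: degree_pcompose)
  then have pos: "degree b > 0" "degree d > 0" by simp_all
  note b = fls_supported_right_factor[OF refl]
  note d = fls_supported_right_factor[OF assms(1)]
  obtain v where v: "degree v = degree b" "fls_supported (degree b) (poly_fls (pcompose v d) X)"
    using exists_lcm_element[OF b refl pos(1) d refl pos(2)] by blast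
  obtain u where u: "pcompose v d = pcompose u b"
    using fls_supported_imp_pcompose[OF b refl pos(1) v(2)] by blast
  have "degree u * degree b = degree v * degree d"
    using arg_cong[OF u, of degree] by (simp add: degree_pcompose)
  then have deg_u: "degree u = degree d" using v(1) pos by simp
  let ?ml = "degree b * degree d"
  have "fls_supported (degree d) (poly_fls (pcompose v d) X)"
    using fls_supported_poly[OF d pos(2)] by (simp add: poly_fls_pcompose)
  then have "fls_supported ?ml (poly_fls (pcompose v d) X)"
    using v(2) cop unfolding fls_supported_def by (auto intro!: divides_mult)
  moreover have "degree (pcompose v d) = ?ml" by (simp add: degree_pcompose v)
  moreover have "?ml > 0" using pos by simp
  moreover have "?ml dvd degree (pcompose a b)"
  proof (rule divides_mult[OF _ _ cop])
    show "degree b dvd degree (pcompose a b)" by (simp add: degree_pcompose)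
    show "degree d dvd degree (pcompose a b)" unfolding eq by (simp add: degree_pcompose)
  qed
  ultimately obtain w where w: "pcompose a b = pcompose w (pcompose v d)"
    using fls_supported_imp_pcompose[OF _ _ _ fls_supported_f] by blast
  have "pcompose a b = pcompose (pcompose w u) b"
    unfolding w u by (rule pcompose_assoc)
  moreover have "pcompose c d = pcompose (pcompose w v) d"
    unfolding eq[symmetric] w by (rule pcompose_assoc)
  ultimately have "a = pcompose w u" "c = pcompose w v"
    using pcompose_right_cancel pos by blast+
  then show ?thesis using u[symmetric] deg_u v(1) by blast
qed

subsection \<open>Prime decompositions\<close>

lemma linear_poly_inverse:
  fixes L :: "'a::field poly"
  assumes "degree L = 1"
  obtains L' where "degree L' = 1" "pcompose L L' = [:0, 1:]" "pcompose L' L = [:0, 1:]"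
proof -
  obtain a b where L: "L = [:a, b:]" "b \<noteq> 0"
    using assms degree1_coeffs by (metis One_nat_def)
  show thesis
    by (rule that[of "[:- a / b, 1 / b:]"]) (use L(2) in \<open>simp_all add: L(1) pcompose_pCons\<close>)
qed

lemma pcompose_idL: "pcompose [:0, 1:] p = (p :: 'a::comm_ring_1 poly)"
  by (simp add: pcompose_pCons)

lemma comp_primeD: "comp_prime P \<Longrightarrow> P = pcompose Q R \<Longrightarrow> degree Q = 1 \<or> degree R = 1"
  unfolding comp_prime_def by blast

lemma comp_prime_degree_prime:
  assumes "degree P = 1 \<or> prime (degree P)"
  shows "comp_prime P"
  unfolding comp_prime_def
proof (intro conjI allI impI)
  show "degree P > 0" using assms prime_gt_0_nat by auto
  fix Q R assume "P = pcompose Q R"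
  then have "degree P = degree Q * degree R" by (simp add: degree_pcompose)
  then show "degree Q = 1 \<or> degree R = 1"
    using assms prime_product[of "degree Q" "degree R"] by auto
qed

lemma comp_prime_pcompose_linear:
  assumes "comp_prime b" "degree L = 1"
  shows "comp_prime (pcompose b L)"
  unfolding comp_prime_def
proof (intro conjI allI impI)
  show "degree (pcompose b L) > 0" using assms by (simp add: degree_pcompose comp_prime_def)
  fix Q R assume eq: "pcompose b L = pcompose Q R"
  obtain L' where L': "degree L' = 1" "pcompose L L' = [:0, 1:]"
    using linear_poly_inverse[OF assms(2)] by metis
  have "b = pcompose (pcompose b L) L'" by (simp flip: pcompose_assoc add: L'(2))
  also have "\<dots> = pcompose Q (pcompose R L')" by (simp add: eq pcompose_assoc)
  finally have "degree Q = 1 \<or> degree (pcompose R L') = 1"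
    using assms(1) unfolding comp_prime_def by blast
  then show "degree Q = 1 \<or> degree R = 1" by (simp add: degree_pcompose L'(1))
qed

lemma comp_list_Nil [simp]: "comp_list [] = [:0, 1:]"
  and comp_list_Cons [simp]: "comp_list (P # Ps) = pcompose P (comp_list Ps)"
  by (simp_all add: comp_list_def)

lemma comp_list_append: "comp_list (Ps @ Qs) = pcompose (comp_list Ps) (comp_list Qs)"
  by (induction Ps) (simp_all add: pcompose_idL pcompose_assoc)

lemma degree_comp_list: "degree (comp_list Ps) = prod_list (map degree Ps)"
  by (induction Ps) (simp_all add: degree_pcompose)

lemma prime_decomposition_append:
  assumes "prime_decomposition P Ps" "prime_decomposition Q Qs"
  shows "prime_decomposition (pcompose P Q) (Ps @ Qs)"
  using assms by (auto simp: prime_decomposition_def comp_list_append)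

lemma prime_decomposition_single: "comp_prime P \<Longrightarrow> prime_decomposition P [P]"
  by (simp add: prime_decomposition_def)

lemma prime_decomposition_degree_pos:
  assumes "prime_decomposition P Ps"
  shows "degree P > 0"
proof -
  have "0 \<notin> set (map degree Ps)" using assms by (auto simp: prime_decomposition_def comp_prime_def)
  then have "degree (comp_list Ps) \<noteq> 0" by (simp add: degree_comp_list prod_list_zero_iff)
  then show ?thesis using assms by (simp add: prime_decomposition_def)
qed

lemma exists_prime_decomposition: "degree P > 0 \<Longrightarrow> \<exists>Ps. prime_decomposition P Ps"
proof (induction "degree P" arbitrary: P rule: less_induct)
  case less
  show ?case
  proof (cases "comp_prime P")
    case True
    then show ?thesis using prime_decomposition_single by blast
  next
    case False
    then obtain Q R where QR: "P = pcompose Q R" "degree Q \<noteq> 1" "degree R \<noteq> 1"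
      using less.prems by (auto simp: comp_prime_def)
    then have "degree Q * degree R > 0" using less.prems by (simp add: degree_pcompose)
    then have "degree Q > 1" "degree R > 1" using QR by auto
    then have "degree Q < degree P" "degree R < degree P" by (simp_all add: QR(1) degree_pcompose)
    then obtain Qs Rs where "prime_decomposition Q Qs" "prime_decomposition R Rs"
      using less.hyps \<open>degree Q > 1\<close> \<open>degree R > 1\<close> by (meson less_trans zero_less_one)
    then show ?thesis using prime_decomposition_append QR(1) by blast
  qed
qed

section \<open>Degree weights and Ritt's exchange argument\<close>

definition degree_weight :: "(nat \<Rightarrow> 'a::comm_monoid_mult) \<Rightarrow> 'b::zero poly list \<Rightarrow> 'a" where
  "degree_weight w Ps = prod_list (map (\<lambda>P. w (degree P)) Ps)"

lemma degree_weight_simps [simp]: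
  "degree_weight w [] = 1"
  "degree_weight w (P # Ps) = w (degree P) * degree_weight w Ps"
  "degree_weight w (Ps @ Qs) = degree_weight w Ps * degree_weight w Qs"
  by (simp_all add: degree_weight_def)

text \<open>Trailing linear factors are absorbed into the factor on their left, and
  \<open>w 1 = 1\<close> keeps the weight unchanged.\<close>

lemma prime_decomposition_last_factor:
  assumes "w 1 = 1" "prime_decomposition f Ps" "degree f > 1"
  shows "\<exists>g Gs b. f = pcompose g b \<and> comp_prime b \<and> degree b > 1 \<and> prime_decomposition g Gs \<and>
    degree_weight w Ps = degree_weight w Gs * w (degree b)"
  using assms(2,3)
proof (induction Ps arbitrary: f rule: rev_induct)
  case Nil
  then show ?case by (simp add: prime_decomposition_def)
next
  case (snoc p Ps)
  have p: "comp_prime p" and Ps: "\<forall>Q\<in>set Ps. comp_prime Q" and f: "f = pcompose (comp_list Ps) p"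
    using snoc.prems by (auto simp: prime_decomposition_def comp_list_append)
  show ?case
  proof (cases "Ps = []")
    case True
    \<comment> \<open>A decomposition is a non-empty list, so the trivial cofactor is decomposed as
      the identity, of weight 1.\<close>
    have "prime_decomposition [:0, 1:] [[:0, 1:]]"
      by (intro prime_decomposition_single comp_prime_degree_prime) simp
    then show ?thesis
      using True f p snoc.prems(2) assms(1)
      by (intro exI[of _ "[:0, 1:]"] exI[of _ "[[:0, 1:]]"] exI[of _ p]) (simp add: pcompose_idL)
  next
    case False
    then have dec: "prime_decomposition (comp_list Ps) Ps"
      using Ps by (simp add: prime_decomposition_def)
    show ?thesis
    proof (cases "degree p = 1")
      case True
      then have "degree (comp_list Ps) > 1" using snoc.prems(2) by (simp add: f degree_pcompose)
      then obtain g Gs b where g: "comp_list Ps = pcompose g b" "comp_prime b" "degree b > 1"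
        "prime_decomposition g Gs" "degree_weight w Ps = degree_weight w Gs * w (degree b)"
        using snoc.IH[OF dec] by blast
      have "f = pcompose g (pcompose b p)" by (simp add: f g(1) pcompose_assoc)
      moreover have "comp_prime (pcompose b p)" by (rule comp_prime_pcompose_linear[OF g(2) True])
      ultimately show ?thesis
        using g True assms(1)
        by (intro exI[of _ g] exI[of _ Gs] exI[of _ "pcompose b p"]) (simp add: degree_pcompose)
    next
      case False
      then have "degree p > 1" using p by (simp add: comp_prime_def)
      then show ?thesis using dec p f
        by (intro exI[of _ "comp_list Ps"] exI[of _ Ps] exI[of _ p]) simp
    qed
  qed
qed

text \<open>A splitting of \<open>u\<close> into \<open>u1\<close> and \<open>u2\<close> makes
  \<open>pcompose u2 b\<close> and \<open>d\<close> right factors of one polynomial. By coprimality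
  the gcd of their degrees is \<open>degree u2\<close>, so \<open>d\<close> has a right factor of
  that degree, and primality of \<open>d\<close> decides.\<close>

lemma comp_prime_cofactor:
  assumes d: "comp_prime d" and eq: "pcompose u b = pcompose v d" and "degree b > 0"
    and cop: "coprime (degree b) (degree d)" and deg: "degree u = degree d"
  shows "comp_prime u"
  unfolding comp_prime_def
proof (intro conjI allI impI)
  show pos: "degree u > 0" using d deg by (simp add: comp_prime_def)
  fix u1 u2 assume u: "u = pcompose u1 u2"
  then have deg_d: "degree d = degree u1 * degree u2" using deg by (simp add: degree_pcompose)
  have "pcompose u1 (pcompose u2 b) = pcompose v d" using eq by (simp add: u pcompose_assoc)
  moreover have "degree (pcompose u1 (pcompose u2 b)) > 0"
    using pos \<open>degree b > 0\<close> by (simp add: u degree_pcompose)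
  ultimately obtain e q r where e: "degree e = gcd (degree (pcompose u2 b)) (degree d)" "d = pcompose r e"
    using right_factors_gcd by blast
  have "coprime (degree b) (degree u1)" using cop by (simp add: deg_d)
  then have "degree e = degree u2"
    by (simp add: e(1) deg_d degree_pcompose gcd_mult_distrib_nat[symmetric] mult.commute[of "degree u1"])
  moreover have "degree r = 1 \<or> degree e = 1" by (rule comp_primeD[OF d e(2)])
  moreover have "degree d = degree r * degree e" using arg_cong[OF e(2), of degree] by (simp add: degree_pcompose)
  ultimately show "degree u1 = 1 \<or> degree u2 = 1"
    using deg_d pos deg by auto
qed

text \<open>The common right factor \<open>e\<close> decides. If it is not linear, primality leaves
  only linear left factors, so \<open>b\<close> and \<open>d\<close> differ by a linear map. If it
  is linear, the degrees are coprime and a common left multiple exchanges them.\<close>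

lemma prime_right_factors_cases:
  assumes eq: "pcompose g b = pcompose g' d" and pos: "degree (pcompose g b) > 0"
    and b: "comp_prime b" "degree b > 1" and d: "comp_prime d" "degree d > 1"
  obtains (linear) L where "degree L = 1" "d = pcompose L b" "g = pcompose g' L"
  | (coprime) w u v where "comp_prime u" "comp_prime v" "degree u = degree d" "degree v = degree b"
      "g = pcompose w u" "g' = pcompose w v"
proof -
  obtain e q r where e: "degree e = gcd (degree b) (degree d)" "b = pcompose q e" "d = pcompose r e"
    using right_factors_gcd[OF eq pos] by blast
  show thesis
  proof (cases "degree e = 1")
    case False
    then have qr: "degree q = 1" "degree r = 1"
      using comp_primeD[OF b(1) e(2)] comp_primeD[OF d(1) e(3)] by blast+
    obtain q' where q': "degree q' = 1" "pcompose q' q = [:0, 1:]"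
      using linear_poly_inverse[OF qr(1)] by metis
    define L where "L = pcompose r q'"
    have "degree L = 1" by (simp add: L_def degree_pcompose qr q')
    moreover have dL: "d = pcompose L b"
    proof -
      have "pcompose L b = pcompose r (pcompose (pcompose q' q) e)"
        by (simp only: L_def e(2) pcompose_assoc)
      then show ?thesis by (simp only: q'(2) pcompose_idL e(3))
    qed
    moreover have "pcompose g b = pcompose (pcompose g' L) b"
      unfolding eq dL by (rule pcompose_assoc)
    then have "g = pcompose g' L" using b(2) by (meson pcompose_right_cancel less_trans zero_less_one)
    ultimately show thesis by (rule linear)
  next
    case True
    then have cop: "coprime (degree b) (degree d)" using e(1) by (simp add: coprime_iff_gcd_eq_1)
    obtain w u v where w: "pcompose u b = pcompose v d" "g = pcompose w u" "g' = pcompose w v"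
      "degree u = degree d" "degree v = degree b"
      using right_factors_coprime[OF eq pos cop] by blast
    have "comp_prime u"
      by (rule comp_prime_cofactor[OF d(1) w(1) _ cop w(4)]) (use b in simp)
    moreover have "comp_prime v"
      by (rule comp_prime_cofactor[OF b(1) w(1)[symmetric] _ _ w(5)]) (use d cop in \<open>simp_all add: coprime_commute\<close>)
    ultimately show thesis using w coprime by blast
  qed
qed

text \<open>With \<open>w\<close> arbitrary subject to \<open>w 1 = 1\<close>, this expresses that
  the multiset of non-linear prime degrees is an invariant.\<close>

theorem Ritt_degree_weight:
  assumes "w 1 = 1" "prime_decomposition f Ps" "prime_decomposition f Qs"
  shows "degree_weight w Ps = degree_weight w Qs"
  using assms(2,3)
proof (induction "degree f" arbitrary: f Ps Qs rule: less_induct)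
  case less
  have pos: "degree f > 0" by (rule prime_decomposition_degree_pos[OF less.prems(1)])
  show ?case
  proof (cases "degree f = 1")
    case True
    have "degree_weight w Rs = 1" if "prime_decomposition f Rs" for Rs
    proof -
      have "prod_list (map degree Rs) = 1"
        using that True by (simp add: prime_decomposition_def flip: degree_comp_list)
      then show ?thesis using assms(1) by (induction Rs) auto
    qed
    then show ?thesis using less.prems by simp
  next
    case False
    then have f1: "degree f > 1" using pos by simp
    obtain g Gs b where g: "f = pcompose g b" "comp_prime b" "degree b > 1" "prime_decomposition g Gs"
      "degree_weight w Ps = degree_weight w Gs * w (degree b)"
      using prime_decomposition_last_factor[of w, OF assms(1) less.prems(1) f1] by blast
    obtain g' Gs' d where g': "f = pcompose g' d" "comp_prime d" "degree d > 1" "prime_decomposition g' Gs'"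
      "degree_weight w Qs = degree_weight w Gs' * w (degree d)"
      using prime_decomposition_last_factor[of w, OF assms(1) less.prems(2) f1] by blast
    have less_g: "degree g < degree f" "degree g' < degree f"
    proof -
      have 1: "degree f = degree g * degree b" and 2: "degree f = degree g' * degree d"
        using arg_cong[OF g(1), of degree] arg_cong[OF g'(1), of degree] by (simp_all add: degree_pcompose)
      show "degree g < degree f" using 1 pos g(3) by simp
      show "degree g' < degree f" using 2 pos g'(3) by simp
    qed
    have eq: "pcompose g b = pcompose g' d" using g(1) g'(1) by simp
    have pos': "degree (pcompose g b) > 0" using g(1) pos by simp
    from eq pos' g(2,3) g'(2,3) show ?thesis
    proof (cases rule: prime_right_factors_cases)
      case (linear L)
      have "prime_decomposition g (Gs' @ [L])"
        unfolding linear(3) using linear(1)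
        by (intro prime_decomposition_append g'(4) prime_decomposition_single comp_prime_degree_prime) simp
      then have "degree_weight w Gs = degree_weight w (Gs' @ [L])"
        by (intro less.hyps[OF less_g(1) g(4)])
      then show ?thesis using linear assms(1) g(5) g'(5) by (simp add: degree_pcompose)
    next
      case (coprime v u u')
      have "degree g > 0" by (rule prime_decomposition_degree_pos[OF g(4)])
      then have "degree v > 0" by (simp add: coprime(5) degree_pcompose)
      \<comment> \<open>The common left part \<open>v\<close> links both sides: \<open>Gs\<close>
        weighs as much as \<open>Vs\<close> followed by \<open>u\<close>, and \<open>Gs'\<close> as
        \<open>Vs\<close> followed by \<open>u'\<close>. Since \<open>u\<close> has the degree of
        \<open>d\<close> and \<open>u'\<close> that of \<open>b\<close>, the totals agree.\<close>
      then obtain Vs where Vs: "prime_decomposition v Vs" using exists_prime_decomposition by blast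
      have "degree_weight w Gs = degree_weight w (Vs @ [u])"
        by (rule less.hyps[OF less_g(1) g(4)])
          (simp add: coprime prime_decomposition_append prime_decomposition_single Vs)
      moreover have "degree_weight w Gs' = degree_weight w (Vs @ [u'])"
        by (rule less.hyps[OF less_g(2) g'(4)])
          (simp add: coprime prime_decomposition_append prime_decomposition_single Vs)
      ultimately show ?thesis using g(5) g'(5) coprime(3,4) by (simp add: mult_ac)
    qed
  qed
qed

subsection \<open>The character\<close>

lemma poly_single_root:
  fixes p :: "complex poly"
  assumes "\<And>z. poly p z = 0 \<Longrightarrow> z = a" "p \<noteq> 0"
  shows "p = smult (lead_coeff p) ([:- a, 1:] ^ degree p)"
proof -
  obtain A where A: "size A = degree p" "p = smult (lead_coeff p) (\<Prod>x\<in>#A. [:- x, 1:])"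
    using alg_closed_imp_factorization[OF assms(2)] by blast
  have "x = a" if "x \<in># A" for x
  proof (rule assms(1))
    have "poly (\<Prod>x\<in>#A. [:- x, 1:]) x = 0"
      using that by (auto simp: poly_prod_mset prod_mset_zero_iff)
    then show "poly p x = 0" by (subst A(2)) simp
  qed
  then have "A = replicate_mset (degree p) a"
    using A(1) by (metis set_mset_subset_singletonD singletonI subsetI)
  then have prod: "(\<Prod>x\<in>#A. [:- x, 1:]) = [:- a, 1:] ^ degree p" by simp
  show ?thesis using A(2) unfolding prod .
qed

text \<open>The two totally ramified points of \<open>z\<^sup>4\<close> carry over to any member of its Hurwitz class; for a
  polynomial one of them can be taken finite.\<close>

lemma Hurwitz_class_power4:
  assumes "degree P = 4" "poly_map P \<in> Hurwitz_class (poly_map (monom 1 4))"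
  shows "\<exists>a c w. P = smult c ([:- a, 1:] ^ 4) + [:w:]"
proof -
  let ?M = "poly_map (monom 1 4)"
  obtain \<phi> \<psi> where hom: "homeomorphic_map sphere_topology sphere_topology \<phi>"
      "homeomorphic_map sphere_topology sphere_topology \<psi>" and eq: "poly_map P \<circ> \<phi> = \<psi> \<circ> ?M"
    using assms(2) unfolding Hurwitz_class_def by blast
  have inj: "inj \<psi>" and surj: "surj \<phi>"
    using homeomorphic_imp_injective_map[OF hom(2)] homeomorphic_imp_surjective_map[OF hom(1)] by simp_all
  \<comment> \<open>The two points whose only preimage under \<open>z^4\<close> is the point
    itself.\<close>
  define E where "E = {None, Some (0 :: complex)}"
  have M_E: "?M x = p \<longleftrightarrow> x = p" if "p \<in> E" for x p
    using that by (cases x) (auto simp: E_def poly_map_None degree_monom_eq poly_monom)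
  have tot: "y = \<phi> p" if "p \<in> E" "poly_map P y = \<psi> p" for y p
  proof -
    obtain x where x: "y = \<phi> x" using surj by blast
    have "\<psi> (?M x) = \<psi> p" using that(2) fun_cong[OF eq, of x] by (simp add: x)
    then have "?M x = p" using inj by (simp add: inj_eq)
    then show ?thesis using M_E[OF that(1)] x by simp
  qed
  \<comment> \<open>Injectivity makes at least one of the two values finite; its preimage is finite
    too, since \<open>P\<close> fixes infinity.\<close>
  have "\<psi> None \<noteq> \<psi> (Some 0)" using inj by (simp add: inj_eq)
  then have "\<exists>p\<in>E. \<psi> p \<noteq> None" by (auto simp: E_def)
  then obtain p w where p: "p \<in> E" "\<psi> p = Some w" by auto
  have "poly_map P (\<phi> p) = Some w"
    using fun_cong[OF eq, of p] M_E[OF p(1), of p] p(2) by simp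
  then obtain a where a: "\<phi> p = Some a"
    using assms(1) by (cases "\<phi> p") (auto simp: poly_map_None)
  let ?q = "P - [:w:]"
  have deg: "degree ?q = 4"
    using assms(1) by (simp add: diff_conv_add_uminus degree_add_eq_left del: add_uminus_conv_diff)
  have "?q = smult (lead_coeff ?q) ([:- a, 1:] ^ degree ?q)"
  proof (rule poly_single_root)
    fix z assume "poly ?q z = 0"
    then show "z = a" using tot[OF p(1), of "Some z"] p(2) a by simp
  qed (use deg in auto)
  then have "P - [:w:] = smult (lead_coeff ?q) ([:- a, 1:] ^ 4)" unfolding deg .
  then have "P = smult (lead_coeff ?q) ([:- a, 1:] ^ 4) + [:w:]" unfolding diff_eq_eq .
  then show ?thesis by blast
qed

lemma phi2_prime_comp_prime:
  assumes "comp_prime P"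
  shows "phi2_prime P = (if degree P = 4 then 4 else 1)"
proof (cases "degree P = 4 \<and> poly_map P \<in> Hurwitz_class (poly_map (monom 1 4))")
  case True
  then obtain a c w where P: "P = smult c ([:- a, 1:] ^ 4) + [:w:]"
    using Hurwitz_class_power4 by blast
  \<comment> \<open>The fourth power is a square of a square, so such a \<open>P\<close> splits into
    two quadratics.\<close>
  let ?Q = "[:w, 0, c:]" and ?R = "[:- a, 1:] ^ 2 :: complex poly"
  have "[:- a, 1:] ^ 4 = ?R * ?R" by (simp flip: power_add)
  then have "P = pcompose ?Q ?R" unfolding P by (simp only: pcompose_pCons pcompose_0) (simp add: algebra_simps)
  then have "degree ?Q = 1 \<or> degree ?R = 1" by (rule comp_primeD[OF assms])
  moreover have "degree ?R = 2" by (simp add: degree_power_eq)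
  moreover have "degree ?Q \<noteq> 1" by simp
  ultimately show ?thesis by simp
qed (auto simp: phi2_prime_def)

definition quartic_weight :: "nat \<Rightarrow> complex" where
  "quartic_weight d = (if d = 4 then 4 else 1)"

lemma prod_phi2_prime:
  assumes "prime_decomposition P Ps"
  shows "prod_list (map phi2_prime Ps) = degree_weight quartic_weight Ps"
proof -
  have "map phi2_prime Ps = map (\<lambda>P. quartic_weight (degree P)) Ps"
    using assms by (auto simp: prime_decomposition_def phi2_prime_comp_prime quartic_weight_def)
  then show ?thesis unfolding degree_weight_def by (rule arg_cong)
qed

lemma phi2_prime_decomposition_unique:
  assumes "prime_decomposition P Ps" "prime_decomposition P Qs"
  shows "prod_list (map phi2_prime Ps) = prod_list (map phi2_prime Qs)"
  unfolding prod_phi2_prime[OF assms(1)] prod_phi2_prime[OF assms(2)]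
  by (rule Ritt_degree_weight[where w = quartic_weight, OF _ assms]) (simp add: quartic_weight_def)

lemma phi2_decomposition:
  assumes "prime_decomposition P Ps"
  shows "phi2 P = prod_list (map phi2_prime Ps)"
proof -
  have "(THE v. \<exists>Ps. prime_decomposition P Ps \<and> v = prod_list (map phi2_prime Ps)) =
      prod_list (map phi2_prime Ps)"
    using assms phi2_prime_decomposition_unique by (intro the_equality) blast+
  then show ?thesis using prime_decomposition_degree_pos[OF assms] by (simp add: phi2_def)
qed

lemma phi2_const: "degree P = 0 \<Longrightarrow> phi2 P = 0"
  by (simp add: phi2_def)

lemma phi2_comp_prime: "comp_prime P \<Longrightarrow> phi2 P = phi2_prime P"
  using phi2_decomposition[OF prime_decomposition_single] by simp

lemma phi2_degree_prime: "degree P = 1 \<or> prime (degree P) \<Longrightarrow> phi2 P = 1"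
  using comp_prime_degree_prime[of P] phi2_comp_prime[of P] phi2_prime_comp_prime[of P]
  by auto

lemma phi2_pcompose: "phi2 (pcompose P Q) = phi2 P * phi2 Q"
proof (cases "degree P = 0 \<or> degree Q = 0")
  case True
  then show ?thesis by (auto simp: phi2_const degree_pcompose)
next
  case False
  then obtain Ps Qs where *: "prime_decomposition P Ps" "prime_decomposition Q Qs"
    using exists_prime_decomposition by blast
  then show ?thesis
    using phi2_decomposition[OF prime_decomposition_append[OF *]]
    by (simp add: phi2_decomposition[OF *(1)] phi2_decomposition[OF *(2)])
qed

lemma phi2_prod_list:
  assumes "prime_decomposition P Ps"
  shows "phi2 P = prod_list (map phi2 Ps)"
proof -
  have "map phi2 Ps = map phi2_prime Ps"
    using assms by (auto simp: prime_decomposition_def phi2_comp_prime)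
  then show ?thesis unfolding phi2_decomposition[OF assms] by (rule arg_cong[OF sym])
qed

text \<open>It has a simple zero at \<open>0\<close> and a triple one at \<open>- 4 / 27\<close>.
  The coefficients are those for which conjugation by inversion gives
  \<open>w^4 / (4 w + 27)^3\<close>, as needed in \<open>no_Rat_extension\<close>.\<close>

definition quartic_example :: "complex poly" where
  "quartic_example = [:0, 1:] * [:4, 27:] ^ 3"

lemma degree_quartic_example: "degree quartic_example = 4"
  by (simp add: quartic_example_def degree_mult_eq degree_power_eq del: mult_pCons_left)

lemma poly_quartic_example: "poly quartic_example x = x * (4 + 27 * x) ^ 3"
  by (simp add: quartic_example_def mult.commute)

text \<open>A decomposition into quadratics would make the quartic symmetric about a point.\<close>

lemma comp_prime_quartic_example: "comp_prime quartic_example"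
  unfolding comp_prime_def
proof (intro conjI allI impI)
  show "degree quartic_example > 0" by (simp add: degree_quartic_example)
  fix Q R assume eq: "quartic_example = pcompose Q R"
  have mult: "degree Q * degree R = 4"
    using degree_quartic_example by (simp add: eq degree_pcompose)
  show "degree Q = 1 \<or> degree R = 1"
  proof (rule ccontr)
    assume no: "\<not> (degree Q = 1 \<or> degree R = 1)"
    have "degree R \<le> 4" using mult by (metis dvd_imp_le dvd_triv_right zero_less_numeral)
    then have "degree R \<in> {0, 1, 2, 3, 4}" by auto
    then have "degree R = 2" using no mult by auto
    then obtain c2 c1 c0 where R: "R = [:c0, c1, c2:]" "c2 \<noteq> 0"
      by (rule degree2_coeffs)
    \<comment> \<open>The sum of the roots of \<open>R\<close>; the reflection
      \<open>x -> s - x\<close> preserves \<open>R\<close>, hence the quartic.\<close>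
    define s where "s = - c1 / c2"
    have "c1 = - c2 * s" using R(2) by (simp add: s_def)
    then have "poly R (s - x) = poly R x" for x by (simp add: R(1) algebra_simps)
    then have sym: "poly quartic_example (s - x) = poly quartic_example x" for x
      by (simp add: eq poly_pcompose)
    \<comment> \<open>The reflection takes the zero \<open>0\<close> to a zero, which leaves two
      values of \<open>s\<close>; the point \<open>4 / 27\<close> refutes both.\<close>
    have "s = 0 \<or> 4 + 27 * s = 0"
      using sym[of 0] by (simp add: poly_quartic_example)
    moreover have "s = ((4 + 27 * s) - 4) / 27" by simp
    ultimately consider "s = 0" | "s = - 4 / 27" by fastforce
    then show False
    proof cases
      case 1
      then show False using sym[of "4 / 27"] by (simp add: poly_quartic_example)
    next
      case 2
      then show False using sym[of "4 / 27"] by (simp add: poly_quartic_example)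
    qed
  qed
qed

lemma phi2_quartic_example: "phi2 quartic_example = 4"
  using phi2_comp_prime[OF comp_prime_quartic_example] phi2_prime_comp_prime[OF comp_prime_quartic_example]
  by (simp add: degree_quartic_example)

text \<open>Degree 4 carries two values: \<open>z^4\<close> is \<open>z^2\<close> composed with
  itself and has value 1, while the prime quartic has value 4.\<close>

lemma not_elementary_phi2: "\<not> elementary phi2"
proof
  assume "elementary phi2"
  then obtain f where f: "\<And>P. phi2 P = f (degree P)" unfolding elementary_def by blast
  let ?q = "[:0, 0, 1:] :: complex poly"
  have deg: "degree ?q = 2" by simp
  have "phi2 ?q = 1" by (rule phi2_degree_prime) (simp only: deg two_is_prime_nat simp_thms)
  have "degree (pcompose ?q ?q) = 4" by (simp add: degree_pcompose deg)
  then have "f 4 = phi2 (pcompose ?q ?q)" by (simp only: f)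
  also have "\<dots> = 1" by (simp only: phi2_pcompose \<open>phi2 ?q = 1\<close> mult_1)
  finally have "f 4 = 1" .
  moreover have "f 4 = 4"
    using f[of quartic_example] by (simp only: phi2_quartic_example degree_quartic_example)
  ultimately show False by simp
qed

subsection \<open>Rational maps\<close>

definition sphere_inversion :: "sphere \<Rightarrow> sphere" where
  "sphere_inversion = rational_map 1 [:0, 1:]"

lemma sphere_inversion_simps:
  "sphere_inversion None = Some 0"
  "sphere_inversion (Some x) = (if x = 0 then None else Some (1 / x))"
  by (simp_all add: sphere_inversion_def rational_map_def sphere_point_def)

lemma sphere_inversion_in_Rat: "sphere_inversion \<in> Rat"
  unfolding Rat_def sphere_inversion_def mem_Collect_eq by (intro exI[of _ 1] exI[of _ "[:0, 1:]"]) simp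

lemma sphere_inversion_involution: "sphere_inversion \<circ> sphere_inversion = poly_map [:0, 1:]"
proof
  fix z show "(sphere_inversion \<circ> sphere_inversion) z = poly_map [:0, 1:] z"
    by (cases z) (auto simp: sphere_inversion_simps poly_map_None)
qed

text \<open>The constant term of \<open>reflect_poly A\<close> is the leading coefficient of
  \<open>A\<close>. Lowest terms are what membership in \<open>Rat\<close> requires.\<close>

lemma coprime_reflect_poly_monom:
  fixes A :: "complex poly"
  assumes "A \<noteq> 0"
  shows "coprime (reflect_poly A) (monom 1 n)"
proof -
  have "\<not> [:0, 1:] dvd reflect_poly A"
    using assms poly_eq_0_iff_dvd[of "reflect_poly A" 0] by simp
  moreover have "prime_elem [:0, 1::complex:]" by (rule prime_elem_linear_field_poly) simp
  ultimately have "coprime [:0, 1:] (reflect_poly A)" by (rule prime_elem_imp_coprime[rotated])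
  then show ?thesis by (simp add: monom_altdef coprime_commute)
qed

lemma poly_map_sphere_inversion:
  assumes "degree A = n" "n > 0"
  shows "poly_map A \<circ> sphere_inversion = rational_map (reflect_poly A) (monom 1 n)"
    and "sphere_inversion \<circ> poly_map A \<circ> sphere_inversion = rational_map (monom 1 n) (reflect_poly A)"
proof -
  have deg: "degree (reflect_poly A) \<le> n" using degree_reflect_poly_le[of A] assms by simp
  have A0: "poly (reflect_poly A) 0 \<noteq> 0" using assms by auto
  have nz: "poly (reflect_poly A) x = x ^ n * poly A (1 / x)" if "x \<noteq> 0" for x
    using poly_reflect_poly_nz[OF that, of A] assms by (simp add: inverse_eq_divide)
  \<comment> \<open>\<open>rational_map\<close> reads its value at infinity off the coefficients at
    the common degree \<open>n\<close>; it has to be \<open>A(0)\<close>, as inversion sends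
    infinity to \<open>0\<close>.\<close>
  have cn: "coeff (reflect_poly A) n = poly A 0"
    using assms by (simp add: coeff_reflect_poly poly_0_coeff_0)
  have max: "max (degree (reflect_poly A)) n = n" "max n (degree (reflect_poly A)) = n" using deg by simp_all
  show "poly_map A \<circ> sphere_inversion = rational_map (reflect_poly A) (monom 1 n)"
  proof
    fix z show "(poly_map A \<circ> sphere_inversion) z = rational_map (reflect_poly A) (monom 1 n) z"
      using assms max by (cases z)
        (auto simp: sphere_inversion_simps rational_map_def sphere_point_def poly_map_None
          degree_monom_eq poly_monom nz cn Let_def)
  qed
  show "sphere_inversion \<circ> poly_map A \<circ> sphere_inversion = rational_map (monom 1 n) (reflect_poly A)"
  proof
    fix z show "(sphere_inversion \<circ> poly_map A \<circ> sphere_inversion) z = rational_map (monom 1 n) (reflect_poly A) z"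
      using assms max A0 by (cases z)
        (auto simp: sphere_inversion_simps rational_map_def sphere_point_def poly_map_None
          degree_monom_eq poly_monom nz cn Let_def)
  qed
qed

lemma conjugate_in_Rat:
  assumes "degree A > 0"
  shows "poly_map A \<circ> sphere_inversion \<in> Rat" "sphere_inversion \<circ> poly_map A \<circ> sphere_inversion \<in> Rat"
proof -
  have "coprime (reflect_poly A) (monom 1 (degree A))"
    using assms by (intro coprime_reflect_poly_monom) auto
  moreover from this have "coprime (monom 1 (degree A)) (reflect_poly A)"
    by (simp add: coprime_commute)
  ultimately show "poly_map A \<circ> sphere_inversion \<in> Rat" "sphere_inversion \<circ> poly_map A \<circ> sphere_inversion \<in> Rat"
    unfolding poly_map_sphere_inversion[OF refl assms] Rat_def mem_Collect_eq
    by blast+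
qed

section \<open>The identity between rational maps\<close>

lemma poly_quadratic_inverse_eq:
  fixes x :: "'a::field_char_0"
  assumes "x \<noteq> 0"
  shows "poly [:1, 3, 9 / 2:] (1 / x) = (2 * x ^ 2 + 6 * x + 9) / (2 * x ^ 2)"
  using assms by (simp add: field_simps power2_eq_square)

text \<open>Later \<open>q\<close> is \<open>2 x^2 + 6 x + 9\<close> and \<open>a\<close> is
  \<open>4 x q + 27\<close>; the second hypothesis is the relation between them behind the
  identity.\<close>

lemma quartic_identity_inner:
  fixes x q a :: "'a::field_char_0"
  assumes "x \<noteq> 0" "4 * x ^ 4 + 3 * a = q ^ 2"
  shows "(q / (2 * x ^ 2)) ^ 2 - 1 = 3 * a / (4 * x ^ 4)"
proof -
  have "(q / (2 * x ^ 2)) ^ 2 - 1 = (q ^ 2 - 4 * x ^ 4) / (4 * x ^ 4)"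
    using assms(1) by (simp add: power_divide power_mult_distrib diff_divide_distrib flip: power_mult)
  also have "\<dots> = 3 * a / (4 * x ^ 4)" by (simp add: assms(2)[symmetric])
  finally show ?thesis .
qed

lemma quartic_identity_outer:
  fixes x q a :: "'a::field_char_0"
  assumes "a \<noteq> 0" "4 * x ^ 4 + 3 * a = q ^ 2"
  shows "27 / 4 * (4 * x ^ 4 / (3 * a)) * (4 * x ^ 4 / (3 * a) + 1) ^ 2 = (x * q) ^ 4 / a ^ 3"
proof -
  have "4 * x ^ 4 / (3 * a) + 1 = q ^ 2 / (3 * a)"
    using assms(1) by (simp add: add_divide_distrib assms(2)[symmetric])
  then show ?thesis
    by (simp add: power2_eq_square power3_eq_cube power4_eq_xxxx mult_ac)
qed

text \<open>With \<open>\<iota>(z) = 1/z\<close>, the identity is \<open>(\<iota> A \<iota>) B = D (\<iota> G \<iota>)\<close>, where \<open>A\<close> is a prime quartic, \<open>B\<close> and \<open>D\<close>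
  are cubics and \<open>G\<close> is a composition of two quadratics. As \<open>\<Phi>(\<iota>)\<^sup>2 = 1\<close>, conjugation by \<open>\<iota>\<close> does
  not change the value.\<close>

lemma no_Rat_extension:
  assumes "mult_character Rat (\<circ>) \<Phi>" and ext: "\<And>P. \<Phi> (poly_map P) = phi2 P"
  shows False
proof -
  let ?i = sphere_inversion
  have mult: "\<Phi> (s \<circ> t) = \<Phi> s * \<Phi> t" if "s \<in> Rat" "t \<in> Rat" for s t
    using assms(1) that by (simp add: mult_character_def)
  have "\<Phi> ?i * \<Phi> ?i = 1"
    using mult[OF sphere_inversion_in_Rat sphere_inversion_in_Rat]
    by (simp add: sphere_inversion_involution ext phi2_degree_prime)
  then have conj: "\<Phi> (?i \<circ> poly_map A \<circ> ?i) = phi2 A" if "degree A > 0" for A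
    using mult[OF sphere_inversion_in_Rat conjugate_in_Rat(1)[OF that]]
      mult[OF poly_map_in_Rat sphere_inversion_in_Rat, of A]
    by (simp add: ext comp_assoc mult.left_commute)
  let ?A = quartic_example
  \<comment> \<open>\<open>B\<close> is \<open>x (2 x^2 + 6 x + 9)\<close> and \<open>D\<close> is
    \<open>27/4 w (w + 1)^2\<close>. With these constants both sides of the identity become
    \<open>(x q)^4 / a^3\<close>, for \<open>q\<close> and \<open>a\<close> as below.\<close>
  define B where "B = [:0, 9, 6, 2 :: complex:]"
  define D where "D = [:0, 27 / 4, 27 / 2, 27 / 4 :: complex:]"
  define G where "G = pcompose [:- 1, 0, 1:] [:1, 3, 9 / 2 :: complex:]"
  have deg: "degree B = 3" "degree D = 3" "degree G = 4"
    by (simp_all add: B_def D_def G_def degree_pcompose)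
  have phi: "phi2 B = 1" "phi2 D = 1" "phi2 G = 1"
  proof -
    show "phi2 B = 1" "phi2 D = 1" by (simp_all add: phi2_degree_prime deg)
    have "phi2 [:- 1, 0, 1:] = 1" "phi2 [:1, 3, 9 / 2:] = 1"
      by (rule phi2_degree_prime, simp add: numeral_2_eq_2[symmetric])+
    then show "phi2 G = 1" by (simp add: G_def phi2_pcompose)
  qed
  have id: "(?i \<circ> poly_map ?A \<circ> ?i) \<circ> poly_map B = poly_map D \<circ> (?i \<circ> poly_map G \<circ> ?i)"
  proof
    fix z
    show "((?i \<circ> poly_map ?A \<circ> ?i) \<circ> poly_map B) z = (poly_map D \<circ> (?i \<circ> poly_map G \<circ> ?i)) z"
    proof (cases z)
      case None
      have "poly G 0 = 0" by (simp add: G_def poly_pcompose)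
      then show ?thesis using None
        by (simp add: sphere_inversion_simps poly_map_None deg poly_quartic_example)
    next
      case (Some x)
      define q where "q = 2 * x ^ 2 + 6 * x + 9"
      define a where "a = 4 * x * q + 27"
      have B: "poly B x = x * q" by (simp add: B_def q_def power2_eq_square algebra_simps)
      have D: "poly D w = 27 / 4 * w * (w + 1) ^ 2" for w
        by (simp add: D_def power2_eq_square algebra_simps)
      show ?thesis
      \<comment> \<open>The zeros of \<open>x\<close>, \<open>q\<close> and \<open>a\<close> are the
        finite points where some inversion is applied to \<open>0\<close> or infinity; elsewhere the
        identity is one of fractions.\<close>
      proof (cases "x = 0")
        case True
        show ?thesis using True Some B[unfolded True]
          by (simp add: sphere_inversion_simps poly_map_None deg degree_quartic_example D)
      next
        case x: False
        have qq: "4 * x ^ 4 + 3 * a = q ^ 2"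
          by (simp add: q_def a_def power2_eq_square power4_eq_xxxx algebra_simps)
        have y: "poly [:1, 3, 9 / 2:] (1 / x) = q / (2 * x ^ 2)"
          unfolding q_def by (rule poly_quadratic_inverse_eq[OF x])
        have "poly G (1 / x) = (q / (2 * x ^ 2)) ^ 2 - 1"
          by (simp only: G_def poly_pcompose y) (simp add: power2_eq_square)
        also have "\<dots> = 3 * a / (4 * x ^ 4)" by (rule quartic_identity_inner[OF x qq])
        finally have G: "poly G (1 / x) = 3 * a / (4 * x ^ 4)" .
        have D_G: "poly D (1 / poly G (1 / x)) = (x * q) ^ 4 / a ^ 3" if "a \<noteq> 0"
        proof -
          have 1: "1 / poly G (1 / x) = 4 * x ^ 4 / (3 * a)" unfolding G by simp
          show ?thesis unfolding D 1 by (rule quartic_identity_outer[OF that qq])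
        qed
        show ?thesis
        proof (cases "q = 0")
          case True
          then have "a \<noteq> 0" by (simp add: a_def)
          moreover have "poly G (1 / x) \<noteq> 0" using \<open>a \<noteq> 0\<close> x by (simp add: G)
          ultimately show ?thesis using True Some x D_G
            by (simp add: sphere_inversion_simps poly_map_None degree_quartic_example B)
        next
          case q: False
          have A: "poly ?A (1 / (x * q)) = a ^ 3 / (x * q) ^ 4"
            using x q by (simp add: poly_quartic_example a_def field_simps power3_eq_cube power4_eq_xxxx)
          show ?thesis
          proof (cases "a = 0")
            case True
            then show ?thesis using Some x q A G
              by (simp add: sphere_inversion_simps poly_map_None deg B)
          next
            case False
            moreover have "poly G (1 / x) \<noteq> 0" using False x by (simp add: G)
            ultimately show ?thesis using Some x q A D_G
              by (simp add: sphere_inversion_simps B)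
          qed
        qed
      qed
    qed
  qed
  have "\<Phi> ((?i \<circ> poly_map ?A \<circ> ?i) \<circ> poly_map B) = 4"
    by (subst mult) (simp_all add: conjugate_in_Rat poly_map_in_Rat degree_quartic_example conj
       phi2_quartic_example ext phi)
  moreover have "\<Phi> (poly_map D \<circ> (?i \<circ> poly_map G \<circ> ?i)) = 1"
    by (subst mult) (simp_all add: conjugate_in_Rat poly_map_in_Rat deg conj ext phi)
  ultimately show False unfolding id by simp
qed

theorem mainTheorem2:
  shows
    "(\<forall>P. degree P > 0 \<longrightarrow> (\<exists>Ps. prime_decomposition P Ps))
     \<and> (\<forall>P Ps Qs. prime_decomposition P Ps \<longrightarrow> prime_decomposition P Qs \<longrightarrow>
           prod_list (map phi2_prime Ps) = prod_list (map phi2_prime Qs))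
     \<and> (\<forall>c. phi2 [:c:] = 0)
     \<and> (\<forall>P. comp_prime P \<longrightarrow> phi2 P = phi2_prime P)
     \<and> (\<forall>P Ps. prime_decomposition P Ps \<longrightarrow> phi2 P = prod_list (map phi2 Ps))
     \<and> mult_character UNIV pcompose phi2
     \<and> \<not> elementary phi2
     \<and> \<not> (\<exists>\<Phi>. mult_character Rat (\<circ>) \<Phi> \<and> (\<forall>P. \<Phi> (poly_map P) = phi2 P))"
proof (intro conjI allI impI)
  show "mult_character UNIV pcompose phi2" by (simp add: mult_character_def phi2_pcompose)
  show "\<not> (\<exists>\<Phi>. mult_character Rat (\<circ>) \<Phi> \<and> (\<forall>P. \<Phi> (poly_map P) = phi2 P))"
    using no_Rat_extension by blast
  show "\<exists>Ps. prime_decomposition P Ps" if "degree P > 0" for P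
    using that by (rule exists_prime_decomposition)
  show "prod_list (map phi2_prime Ps) = prod_list (map phi2_prime Qs)"
    if "prime_decomposition P Ps" "prime_decomposition P Qs" for P Ps Qs
    using that by (rule phi2_prime_decomposition_unique)
  show "phi2 [:c:] = 0" for c by (simp add: phi2_const)
  show "phi2 P = phi2_prime P" if "comp_prime P" for P using that by (rule phi2_comp_prime)
  show "phi2 P = prod_list (map phi2 Ps)" if "prime_decomposition P Ps" for P Ps
    using that by (rule phi2_prod_list)
qed (rule not_elementary_phi2)

end
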